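(* Assume $R^{\mathsf A}[U|V]\otimes R^{\mathsf A}[W|V]\in L^2(\mathbb P;\mathsf L_2(\mathcal F;\mathcal G))$. Then $$\mathrm{Cov}[U,W]=\mathrm{Cov}\big[\mathbb E^{\mathsf A}[U|V],\mathbb E^{\mathsf A}[W|V]\big]+\mathbb E\big[\mathrm{Cov}^{\mathsf A}[U,W|V]\big].$$ Moreover, in the Loewner order of self-adjoint operators on $\mathcal G$, $$\mathrm{Cov}[U]\ \ge\ \mathrm{Cov}\big[\mathbb E[U|V]\big]\ \ge\ \mathrm{Cov}\big[\mathbb E^{\mathsf A}[U|V]\big]\ \ge\ 0.$$
   Context: Standing setup: - $(\Omega,\Sigma,\mathbb P)$ is a probability space and $\mathcal F,\mathcal G,\mathcal H$ are separable real Hilbert spaces. - $L^2(\mathbb P;\mathcal K)$ is the Bochner space of square-integrable $\mathcal K$-valued random variables. - $U\in L^2(\mathbb P;\mathcal G)$, $V\in L^2(\mathbb P;\mathcal H)$, $W\in L^2(\mathbb P;\mathcal F)$. - For $g\in\mathcal G$ and $f\in\mathcal F$, $g\otimes f:\mathcal F\to\mathcal G$ is given by $f'\mapsto\langle f,f'\rangle_{\mathcal F}\,g$. - $\mathrm{Cov}[U,W]=\mathbb E[(U-\mathbb E U)\otimes(W-\mathbb E W)]$ and $\mathrm{Cov}[U]=\mathrm{Cov}[U,U]$. - $\mathsf L_2(\mathcal F;\mathcal G)$ is the separable Hilbert space of Hilbert–Schmidt operators $\mathcal F\to\mathcal G$. - $\mathsf A(\mathcal H;\mathcal K)$ is the set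 of bounded affine maps $\mathcal H\to\mathcal K$. - $\overline{\mathsf A_{\mathcal K}\circ V}$ is the closure in $L^2(\mathbb P;\mathcal K)$ of $\{\gamma\circ V:\gamma\in\mathsf A(\mathcal H;\mathcal K)\}$. - For $Z\in L^2(\mathbb P;\mathcal K)$, $\mathbb E^{\mathsf A}[Z|V]$ is the orthogonal projection of $Z$ onto $\overline{\mathsf A_{\mathcal K}\circ V}$, and $R^{\mathsf A}[Z|V]:=Z-\mathbb E^{\mathsf A}[Z|V]$. - The linear conditional covariance is $\mathrm{Cov}^{\mathsf A}[U,W|V]:=\mathbb E^{\mathsf A}\big[R^{\mathsf A}[U|V]\otimes R^{\mathsf A}[W|V]\,\big|\,V\big]$, with $\mathcal K=\mathsf L_2(\mathcal F;\mathcal G)$. *)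

theory Defs
  imports "HOL-Probability.Probability"
begin

text \<open>Hilbert spaces are modelled by types of sort
  real_inner + banach (complete) + second_countable_topology (separable).
  Random variables are functions on the sample space of a probability measure M.\<close>

definition L2 :: "'w measure \<Rightarrow> ('w \<Rightarrow> 'k::{real_normed_vector,second_countable_topology}) \<Rightarrow> bool" where
  "L2 M X \<longleftrightarrow> X \<in> borel_measurable M \<and> integrable M (\<lambda>\<omega>. (norm (X \<omega>))\<^sup>2)"

definition tensor :: "'g::real_vector \<Rightarrow> 'f::real_inner \<Rightarrow> ('f \<Rightarrow> 'g)" where
  "tensor g f = (\<lambda>f'. inner f f' *\<^sub>R g)"

text \<open>Covariance operator Cov[U,W] = E[(U - EU) \<otimes> (W - EW)], an operator F \<rightarrow> G,
  given by its action on each f' (the expectation commutes with evaluation).\<close>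
definition cov :: "'w measure \<Rightarrow> ('w \<Rightarrow> 'g::{real_inner,banach,second_countable_topology})
    \<Rightarrow> ('w \<Rightarrow> 'f::{real_inner,banach,second_countable_topology}) \<Rightarrow> ('f \<Rightarrow> 'g)" where
  "cov M U W = (\<lambda>f'. \<integral>\<omega>. tensor (U \<omega> - (\<integral>x. U x \<partial>M)) (W \<omega> - (\<integral>x. W x \<partial>M)) f' \<partial>M)"

definition bounded_affine :: "('h::real_normed_vector \<Rightarrow> 'k::real_normed_vector) \<Rightarrow> bool" where
  "bounded_affine \<gamma> \<longleftrightarrow> (\<exists>L c. bounded_linear L \<and> (\<forall>x. \<gamma> x = L x + c))"

definition aff_closure :: "'w measure \<Rightarrow> ('w \<Rightarrow> 'h::real_normed_vector)
    \<Rightarrow> ('w \<Rightarrow> 'k::{real_normed_vector,second_countable_topology}) set" where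
  "aff_closure M V = {Y. L2 M Y \<and> (\<forall>\<epsilon>>0. \<exists>\<gamma>::'h \<Rightarrow> 'k. bounded_affine \<gamma> \<and>
       integrable M (\<lambda>\<omega>. (norm (Y \<omega> - \<gamma> (V \<omega>)))\<^sup>2) \<and>
       (\<integral>\<omega>. (norm (Y \<omega> - \<gamma> (V \<omega>)))\<^sup>2 \<partial>M) < \<epsilon>)}"

text \<open>Orthogonal projection of Z onto the closed subspace aff_closure M V
  (a representative of the L2 class).\<close>
definition lin_cond_exp :: "'w measure \<Rightarrow> ('w \<Rightarrow> 'h::real_normed_vector)
    \<Rightarrow> ('w \<Rightarrow> 'k::{real_inner,banach,second_countable_topology}) \<Rightarrow> ('w \<Rightarrow> 'k)" where
  "lin_cond_exp M V Z = (SOME Y. Y \<in> aff_closure M V \<and>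
      (\<forall>X\<in>aff_closure M V. (\<integral>\<omega>. inner (Z \<omega> - Y \<omega>) (X \<omega>) \<partial>M) = 0))"

definition lin_resid :: "'w measure \<Rightarrow> ('w \<Rightarrow> 'h::real_normed_vector)
    \<Rightarrow> ('w \<Rightarrow> 'k::{real_inner,banach,second_countable_topology}) \<Rightarrow> ('w \<Rightarrow> 'k)" where
  "lin_resid M V Z = (\<lambda>\<omega>. Z \<omega> - lin_cond_exp M V Z \<omega>)"

text \<open>A fixed orthonormal basis of F (exists in every Hilbert space).\<close>
definition onb :: "'f::real_inner set" where
  "onb = (SOME B. (\<forall>e\<in>B. norm e = 1) \<and> pairwise orthogonal B \<and> closure (span B) = UNIV)"

definition hilbert_schmidt :: "('f::real_inner \<Rightarrow> 'g::real_inner) \<Rightarrow> bool" where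
  "hilbert_schmidt T \<longleftrightarrow> bounded_linear T \<and> (\<lambda>e. (norm (T e))\<^sup>2) summable_on (onb :: 'f set)"

definition hs_inner :: "('f::real_inner \<Rightarrow> 'g::real_inner) \<Rightarrow> ('f \<Rightarrow> 'g) \<Rightarrow> real" where
  "hs_inner S T = (\<Sum>\<^sub>\<infinity>e\<in>(onb :: 'f set). inner (S e) (T e))"

definition hs_norm :: "('f::real_inner \<Rightarrow> 'g::real_inner) \<Rightarrow> real" where
  "hs_norm T = sqrt (hs_inner T T)"

text \<open>Elements of L2(P; L_2(F;G)). Measurability is weak measurability against the
  rank-one operators, which by Pettis' theorem equals strong measurability here.\<close>
definition L2_hs :: "'w measure \<Rightarrow> ('w \<Rightarrow> ('f::real_inner \<Rightarrow> 'g::real_inner)) \<Rightarrow> bool" where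
  "L2_hs M Y \<longleftrightarrow> (\<forall>\<omega>\<in>space M. hilbert_schmidt (Y \<omega>)) \<and>
     (\<forall>f g. (\<lambda>\<omega>. inner (Y \<omega> f) g) \<in> borel_measurable M) \<and>
     integrable M (\<lambda>\<omega>. (hs_norm (Y \<omega>))\<^sup>2)"

definition hs_bounded_affine :: "('h::real_normed_vector \<Rightarrow> ('f::real_inner \<Rightarrow> 'g::real_inner)) \<Rightarrow> bool" where
  "hs_bounded_affine \<gamma> \<longleftrightarrow> (\<exists>L C.
     (\<forall>v. hilbert_schmidt (L v)) \<and> hilbert_schmidt C \<and>
     (\<forall>a b v w. L (a *\<^sub>R v + b *\<^sub>R w) = (\<lambda>x. a *\<^sub>R L v x + b *\<^sub>R L w x)) \<and>
     (\<exists>K. \<forall>v. hs_norm (L v) \<le> K * norm v) \<and>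
     (\<forall>v. \<gamma> v = (\<lambda>x. L v x + C x)))"

definition hs_aff_closure :: "'w measure \<Rightarrow> ('w \<Rightarrow> 'h::real_normed_vector)
    \<Rightarrow> ('w \<Rightarrow> ('f::real_inner \<Rightarrow> 'g::real_inner)) set" where
  "hs_aff_closure M V = {Y. L2_hs M Y \<and> (\<forall>\<epsilon>>0. \<exists>\<gamma>::'h \<Rightarrow> ('f \<Rightarrow> 'g). hs_bounded_affine \<gamma> \<and>
       integrable M (\<lambda>\<omega>. (hs_norm (\<lambda>x. Y \<omega> x - \<gamma> (V \<omega>) x))\<^sup>2) \<and>
       (\<integral>\<omega>. (hs_norm (\<lambda>x. Y \<omega> x - \<gamma> (V \<omega>) x))\<^sup>2 \<partial>M) < \<epsilon>)}"

definition hs_lin_cond_exp :: "'w measure \<Rightarrow> ('w \<Rightarrow> 'h::real_normed_vector)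
    \<Rightarrow> ('w \<Rightarrow> ('f::real_inner \<Rightarrow> 'g::real_inner)) \<Rightarrow> ('w \<Rightarrow> ('f \<Rightarrow> 'g))" where
  "hs_lin_cond_exp M V Z = (SOME Y. Y \<in> hs_aff_closure M V \<and>
      (\<forall>X\<in>hs_aff_closure M V. (\<integral>\<omega>. hs_inner (\<lambda>x. Z \<omega> x - Y \<omega> x) (X \<omega>) \<partial>M) = 0))"

definition lin_cond_cov :: "'w measure \<Rightarrow> ('w \<Rightarrow> 'h::real_normed_vector)
    \<Rightarrow> ('w \<Rightarrow> 'g::{real_inner,banach,second_countable_topology})
    \<Rightarrow> ('w \<Rightarrow> 'f::{real_inner,banach,second_countable_topology}) \<Rightarrow> ('w \<Rightarrow> ('f \<Rightarrow> 'g))" where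
  "lin_cond_cov M V U W = hs_lin_cond_exp M V (\<lambda>\<omega>. tensor (lin_resid M V U \<omega>) (lin_resid M V W \<omega>))"

definition hs_expect :: "'w measure \<Rightarrow> ('w \<Rightarrow> ('f \<Rightarrow> 'g::{real_normed_vector,banach,second_countable_topology})) \<Rightarrow> ('f \<Rightarrow> 'g)" where
  "hs_expect M Y = (\<lambda>f'. \<integral>\<omega>. Y \<omega> f' \<partial>M)"

definition cond_exp_vec :: "'w measure \<Rightarrow> ('w \<Rightarrow> 'h::topological_space)
    \<Rightarrow> ('w \<Rightarrow> 'k::{banach,second_countable_topology}) \<Rightarrow> ('w \<Rightarrow> 'k)" where
  "cond_exp_vec M V U = (SOME Y. Y \<in> borel_measurable (vimage_algebra (space M) V borel) \<and>
      integrable M Y \<and>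
      (\<forall>A\<in>sets (vimage_algebra (space M) V borel).
          set_lebesgue_integral M A Y = set_lebesgue_integral M A U))"

definition loewner_le :: "('g::real_inner \<Rightarrow> 'g) \<Rightarrow> ('g \<Rightarrow> 'g) \<Rightarrow> bool" where
  "loewner_le A B \<longleftrightarrow> (\<forall>g. inner (A g) g \<le> inner (B g) g)"

end

theory Submission
  imports Defs
begin

text \<open>
  In a class of square-integrable Hilbert-space valued functions that is closed under
  almost-everywhere limits, a minimising sequence in a subspace, chosen to be rapidly Cauchy by the
  parallelogram law, converges almost everywhere, and its limit is the orthogonal projection. This
  yields the linear conditional expectation, its Hilbert-Schmidt counterpart, and the Hilbert-valued
  conditional expectation (the projection onto the square-integrable \<open>\<sigma>(V)\<close>-measurable functions,
  identified with any other version by uniqueness of densities).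

  The residuals are orthogonal to all affine functions of V, in particular to constants and to
  \<open>\<langle>E\<^sup>A[U|V] - E U, g\<rangle> f\<close>. Hence means are preserved and the cross terms in \<open>Cov[U,W]\<close> vanish.
  Testing the projection of \<open>R[U|V] \<otimes> R[W|V]\<close> against constant rank-one operators shows that it has
  the expectation of the unprojected tensor. The Loewner chain is Pythagoras' theorem for
  \<open>U - E[U|V]\<close> and \<open>E[U|V] - E\<^sup>A[U|V]\<close>.
\<close>

section \<open>Projections in spaces of square-integrable functions\<close>

text \<open>The projections are chosen by \<open>SOME\<close> among functions, not among classes
  modulo null sets, so an actual pointwise limit is built and shown to have the defining properties.
  The argument is needed for two kinds of values: vectors of a separable Hilbert space and
  Hilbert-Schmidt operators. For operators only weak measurability is available, and the type
  \<open>hs_op\<close> is not equipped with second countability; \<open>L2_class\<close> therefore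
  speaks only of measurable inner products, integrable squared norms and stability under limits. The
  basis \<open>onb\<close> inside the Hilbert-Schmidt norm is itself a \<open>SOME\<close>, so a
  basis has to be constructed before that norm has any known property; its countability then turns
  weak measurability into measurability of norms and inner products. A third obstacle is that
  \<open>cond_exp_vec\<close> is an arbitrary integrable version: its square-integrability is not
  part of its definition and has to be carried over from the projection. Orthogonality in
  vector-valued L2 yields operator identities by testing with functions of the form scalar times
  fixed vector, which reduces every covariance to integrals of products of real functions.\<close>

locale L2_class =
  fixes M :: "'w measure" and C :: "('w \<Rightarrow> 'k::{real_inner,banach}) set"
  assumes lincomb: "X \<in> C \<Longrightarrow> Y \<in> C \<Longrightarrow> (\<lambda>\<omega>. X \<omega> + c *\<^sub>R Y \<omega>) \<in> C"
    and inner_measurable: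
      "X \<in> C \<Longrightarrow> Y \<in> C \<Longrightarrow> (\<lambda>\<omega>. inner (X \<omega>) (Y \<omega>)) \<in> borel_measurable M"
    and square_integrable: "X \<in> C \<Longrightarrow> integrable M (\<lambda>\<omega>. (norm (X \<omega>))\<^sup>2)"
    and lim_closed: "(\<And>n. F n \<in> C) \<Longrightarrow> AE \<omega> in M. convergent (\<lambda>n. F n \<omega>) \<Longrightarrow>
      (\<lambda>n. \<integral>\<^sup>+\<omega>. ennreal ((norm (F n \<omega> - lim (\<lambda>m. F m \<omega>)))\<^sup>2) \<partial>M) \<longlonglongrightarrow> 0 \<Longrightarrow>
      (\<lambda>\<omega>. lim (\<lambda>n. F n \<omega>)) \<in> C"
begin

lemma diff_closed: "X \<in> C \<Longrightarrow> Y \<in> C \<Longrightarrow> (\<lambda>\<omega>. X \<omega> - Y \<omega>) \<in> C"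
  using lincomb[of X Y "-1"] by simp

lemma inner_integrable:
  assumes "X \<in> C" "Y \<in> C"
  shows "integrable M (\<lambda>\<omega>. inner (X \<omega>) (Y \<omega>))"
proof (rule Bochner_Integration.integrable_bound)
  show "integrable M (\<lambda>\<omega>. (norm (X \<omega>))\<^sup>2 + (norm (Y \<omega>))\<^sup>2)"
    by (intro Bochner_Integration.integrable_add square_integrable assms)
  show "(\<lambda>\<omega>. inner (X \<omega>) (Y \<omega>)) \<in> borel_measurable M"
    by (rule inner_measurable[OF assms])
  have "\<bar>inner x y\<bar> \<le> (norm x)\<^sup>2 + (norm y)\<^sup>2" for x y :: 'k
  proof -
    have "2 * (norm x * norm y) \<le> (norm x)\<^sup>2 + (norm y)\<^sup>2"
      using sum_squares_bound[of "norm x" "norm y"] by (simp add: mult.assoc)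
    moreover have "0 \<le> norm x * norm y" by simp
    ultimately show ?thesis using Cauchy_Schwarz_ineq2[of x y] by linarith
  qed
  then show "AE \<omega> in M. norm (inner (X \<omega>) (Y \<omega>)) \<le> norm ((norm (X \<omega>))\<^sup>2 + (norm (Y \<omega>))\<^sup>2)"
    by simp
qed

lemma integral_norm_add_scaleR:
  assumes "X \<in> C" "Y \<in> C"
  shows "(\<integral>\<omega>. (norm (X \<omega> + c *\<^sub>R Y \<omega>))\<^sup>2 \<partial>M) =
    (\<integral>\<omega>. (norm (X \<omega>))\<^sup>2 \<partial>M) + 2 * c * (\<integral>\<omega>. inner (X \<omega>) (Y \<omega>) \<partial>M) + c\<^sup>2 * (\<integral>\<omega>. (norm (Y \<omega>))\<^sup>2 \<partial>M)"
proof -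
  have "(norm (x + c *\<^sub>R y))\<^sup>2 = (norm x)\<^sup>2 + 2 * c * inner x y + c\<^sup>2 * (norm y)\<^sup>2" for x y :: 'k
    by (simp add: power2_norm_eq_inner inner_simps inner_commute algebra_simps power2_eq_square[of c])
  then show ?thesis
    using square_integrable[OF assms(1)] square_integrable[OF assms(2)] inner_integrable[OF assms]
    by simp
qed

text \<open>Expanding the nonnegative integral of \<open>|X - c Y|^2\<close> gives a form of
  Cauchy-Schwarz without square roots of integrals. The free parameter \<open>c\<close>, of either
  sign, is chosen by each application.\<close>

lemma two_integral_inner_le:
  assumes "X \<in> C" "Y \<in> C"
  shows "2 * c * (\<integral>\<omega>. inner (X \<omega>) (Y \<omega>) \<partial>M) \<le>
    (\<integral>\<omega>. (norm (X \<omega>))\<^sup>2 \<partial>M) + c\<^sup>2 * (\<integral>\<omega>. (norm (Y \<omega>))\<^sup>2 \<partial>M)"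
proof -
  have "0 \<le> (\<integral>\<omega>. (norm (X \<omega> + (- c) *\<^sub>R Y \<omega>))\<^sup>2 \<partial>M)" by simp
  then show ?thesis unfolding integral_norm_add_scaleR[OF assms] by simp
qed

text \<open>Pairing with \<open>D\<close> is continuous in the L2 distance, so orthogonality to
  \<open>A\<close> passes to L2 limits of members of \<open>A\<close>.\<close>

lemma orthogonal_closure:
  assumes D: "D \<in> C" and A: "A \<subseteq> C" and orth: "\<And>X. X \<in> A \<Longrightarrow> (\<integral>\<omega>. inner (D \<omega>) (X \<omega>) \<partial>M) = 0"
    and Y: "Y \<in> C" and appr: "\<And>\<epsilon>. \<epsilon> > 0 \<Longrightarrow> \<exists>X\<in>A. (\<integral>\<omega>. (norm (Y \<omega> - X \<omega>))\<^sup>2 \<partial>M) < \<epsilon>"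
  shows "(\<integral>\<omega>. inner (D \<omega>) (Y \<omega>) \<partial>M) = 0"
proof -
  let ?i = "\<integral>\<omega>. inner (D \<omega>) (Y \<omega>) \<partial>M"
  \<comment> \<open>The summand 1 accounts for the approximation error: with
    \<open>|Y - X|^2\<close> integrating to less than \<open>t^2\<close>, the bound
    \<open>two_integral_inner_le\<close> becomes \<open>t^2 * ?K\<close>. It also keeps
    \<open>?K\<close> positive when \<open>D\<close> vanishes.\<close>
  let ?K = "(\<integral>\<omega>. (norm (D \<omega>))\<^sup>2 \<partial>M) + 1"
  have K: "?K > 0" by (smt (verit) integral_nonneg_AE AE_I2 zero_le_power2)
  have b: "2 * \<bar>?i\<bar> \<le> t * ?K" if t: "t > 0" for t
  proof -
    obtain X where X: "X \<in> A" "(\<integral>\<omega>. (norm (Y \<omega> - X \<omega>))\<^sup>2 \<partial>M) < t\<^sup>2"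
      using appr[of "t\<^sup>2"] t by auto
    have XC: "X \<in> C" using X A by auto
    have "?i = (\<integral>\<omega>. inner (D \<omega>) (Y \<omega> - X \<omega>) + inner (D \<omega>) (X \<omega>) \<partial>M)"
      by (simp add: inner_diff_right)
    also have "\<dots> = (\<integral>\<omega>. inner (D \<omega>) (Y \<omega> - X \<omega>) \<partial>M)"
      using inner_integrable[OF D diff_closed[OF Y XC]] inner_integrable[OF D XC] orth[OF X(1)]
      by simp
    finally have i: "?i = (\<integral>\<omega>. inner (Y \<omega> - X \<omega>) (D \<omega>) \<partial>M)" by (simp add: inner_commute)
    have "2 * t * ?i \<le> t\<^sup>2 * ?K" "2 * (-t) * ?i \<le> t\<^sup>2 * ?K"
      using two_integral_inner_le[OF diff_closed[OF Y XC] D, of t]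
        two_integral_inner_le[OF diff_closed[OF Y XC] D, of "-t"] X(2) i
      by (auto simp: algebra_simps)
    then have "t * (2 * \<bar>?i\<bar>) \<le> t * (t * ?K)"
      by (auto simp: abs_if algebra_simps power2_eq_square)
    then show ?thesis using t by simp
  qed
  have "?i = 0"
  proof (rule ccontr)
    assume "?i \<noteq> 0"
    \<comment> \<open>Taking \<open>t\<close> to be this quotient in \<open>b\<close> gives twice
      \<open>|?i|\<close> at most \<open>|?i|\<close>.\<close>
    then have "\<bar>?i\<bar> / ?K > 0" using K by simp
    from b[OF this] K \<open>?i \<noteq> 0\<close> show False by simp
  qed
  then show ?thesis .
qed

text \<open>\<open>A\<close> is a linear class that may fail to be closed, so near-minimisers
  replace the minimiser and orthogonality is reached against \<open>A\<close> itself;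
  \<open>orthogonal_closure\<close> extends it. The sequence is part of the conclusion because each
  application reads off a different closure property of the limit: approximability by affine
  functions, or measurability with respect to a sub-algebra.\<close>

theorem projection_sequence:
  assumes A: "A \<subseteq> C" "A \<noteq> {}"
    and A_lin: "\<And>X Y c. X \<in> A \<Longrightarrow> Y \<in> A \<Longrightarrow> (\<lambda>\<omega>. X \<omega> + c *\<^sub>R Y \<omega>) \<in> A"
    and Z: "Z \<in> C"
  obtains F where "\<And>n. F n \<in> A" "AE \<omega> in M. convergent (\<lambda>n. F n \<omega>)"
    "(\<lambda>\<omega>. lim (\<lambda>n. F n \<omega>)) \<in> C"
    "(\<lambda>n. \<integral>\<omega>. (norm (lim (\<lambda>m. F m \<omega>) - F n \<omega>))\<^sup>2 \<partial>M) \<longlonglongrightarrow> 0"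
    "\<And>X. X \<in> A \<Longrightarrow> (\<integral>\<omega>. inner (Z \<omega> - lim (\<lambda>n. F n \<omega>)) (X \<omega>) \<partial>M) = 0"
proof -
  define q where "q X = (\<integral>\<omega>. (norm (Z \<omega> - X \<omega>))\<^sup>2 \<partial>M)" for X
  define d where "d = Inf (q ` A)"
  \<comment> \<open>The squared increments will integrate to at most \<open>4 * \<delta> n\<close>;
    the rate \<open>4^-n\<close> leaves a summable \<open>2^-n\<close> after they are weighted by
    \<open>2^n\<close>.\<close>
  define \<delta> where "\<delta> n = (1/4 :: real) ^ n" for n :: nat
  have q_nonneg: "q X \<ge> 0" for X unfolding q_def by simp
  have d_le: "d \<le> q X" if "X \<in> A" for X
    unfolding d_def using that q_nonneg by (intro cInf_lower bdd_belowI[of _ 0]) auto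
  have "\<exists>X\<in>A. q X < d + \<delta> n" for n
  proof -
    have "Inf (q ` A) < d + \<delta> n" by (simp add: d_def \<delta>_def)
    then show ?thesis using cInf_lessD[of "q ` A"] A(2) by fastforce
  qed
  then obtain F where F: "\<And>n. F n \<in> A" "\<And>n. q (F n) < d + \<delta> n" by metis
  have FC: "F n \<in> C" for n using F A by auto
  have ZF: "(\<lambda>\<omega>. Z \<omega> - F n \<omega>) \<in> C" for n by (rule diff_closed[OF Z FC])
  have FF: "(\<lambda>\<omega>. F n \<omega> - F m \<omega>) \<in> C" for n m by (rule diff_closed[OF FC FC])
  have A_scale: "(\<lambda>\<omega>. c *\<^sub>R X \<omega>) \<in> A" if "X \<in> A" for X c
    using A_lin[OF that that, of "c - 1"] by (simp add: algebra_simps)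
  \<comment> \<open>Parallelogram law: the midpoint of two almost minimisers has squared distance at least d from Z.\<close>
  have cauchy: "(\<integral>\<omega>. (norm (F n \<omega> - F m \<omega>))\<^sup>2 \<partial>M) \<le> 2 * (\<delta> n + \<delta> m)" for n m
  proof -
    let ?X = "\<lambda>\<omega>. (1/2) *\<^sub>R F n \<omega> + (1/2) *\<^sub>R F m \<omega>"
    have X: "?X \<in> A" by (rule A_lin[OF A_scale[OF F(1)] F(1)])
    then have XC: "?X \<in> C" using A by auto
    have pl: "(norm (a - b))\<^sup>2 = 2 * (norm (z - a))\<^sup>2 + 2 * (norm (z - b))\<^sup>2
        - 4 * (norm (z - ((1/2) *\<^sub>R a + (1/2) *\<^sub>R b)))\<^sup>2" for a b z :: 'k
      by (simp add: power2_norm_eq_inner inner_simps inner_commute algebra_simps)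
    have pl': "(\<integral>\<omega>. (norm (F n \<omega> - F m \<omega>))\<^sup>2 \<partial>M) = (\<integral>\<omega>. 2 * (norm (Z \<omega> - F n \<omega>))\<^sup>2
        + 2 * (norm (Z \<omega> - F m \<omega>))\<^sup>2 - 4 * (norm (Z \<omega> - ?X \<omega>))\<^sup>2 \<partial>M)"
      by (rule Bochner_Integration.integral_cong[OF refl pl])
    have "(\<integral>\<omega>. (norm (F n \<omega> - F m \<omega>))\<^sup>2 \<partial>M) = 2 * q (F n) + 2 * q (F m) - 4 * q ?X"
      unfolding q_def pl'
      using square_integrable[OF ZF[of n]] square_integrable[OF ZF[of m]]
        square_integrable[OF diff_closed[OF Z XC]]
      by simp
    then show ?thesis using F(2)[of n] F(2)[of m] d_le[OF X] by simp
  qed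
  have meas[measurable]: "(\<lambda>\<omega>. (norm (F n \<omega> - F m \<omega>))\<^sup>2) \<in> borel_measurable M" for n m
    using square_integrable[OF FF] by auto
  have nn: "(\<integral>\<^sup>+\<omega>. ennreal ((norm (F n \<omega> - F m \<omega>))\<^sup>2) \<partial>M) =
      ennreal (\<integral>\<omega>. (norm (F n \<omega> - F m \<omega>))\<^sup>2 \<partial>M)" for n m
    by (rule nn_integral_eq_integral[OF square_integrable[OF FF]]) simp
  have conv: "AE \<omega> in M. convergent (\<lambda>n. F n \<omega>)"
  proof -
    \<comment> \<open>The weight \<open>2^n\<close> converts control of squares into control of
      norms: pointwise \<open>a \<le> 2^n * a^2 + 2^-n\<close>, so a.e. summability of the weighted
      squares makes the increments absolutely summable.\<close>
    have *: "(\<integral>\<^sup>+\<omega>. ennreal (2 ^ n * (norm (F (Suc n) \<omega> - F n \<omega>))\<^sup>2) \<partial>M) \<le> ennreal (4 * (1/2) ^ n)" for n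
    proof -
      have "(\<integral>\<^sup>+\<omega>. ennreal (2 ^ n * (norm (F (Suc n) \<omega> - F n \<omega>))\<^sup>2) \<partial>M)
        = ennreal (2 ^ n) * (\<integral>\<^sup>+\<omega>. ennreal ((norm (F (Suc n) \<omega> - F n \<omega>))\<^sup>2) \<partial>M)"
        by (simp add: ennreal_mult nn_integral_cmult)
      also have "\<dots> = ennreal (2 ^ n * (\<integral>\<omega>. (norm (F (Suc n) \<omega> - F n \<omega>))\<^sup>2 \<partial>M))"
        by (simp add: nn ennreal_mult)
      also have "\<dots> \<le> ennreal (2 ^ n * (4 * \<delta> n))"
      proof (intro ennreal_leI mult_left_mono)
        have "\<delta> (Suc n) \<le> \<delta> n" by (simp add: \<delta>_def)
        then have "2 * (\<delta> (Suc n) + \<delta> n) \<le> 4 * \<delta> n" by simp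
        with cauchy[of "Suc n" n] show "(\<integral>\<omega>. (norm (F (Suc n) \<omega> - F n \<omega>))\<^sup>2 \<partial>M) \<le> 4 * \<delta> n"
          by (rule order.trans)
      qed simp
      also have "2 ^ n * (4 * \<delta> n) = 4 * (1/2) ^ n"
        by (simp add: \<delta>_def flip: power_mult_distrib)
      finally show ?thesis .
    qed
    have "(\<integral>\<^sup>+\<omega>. (\<Sum>n. ennreal (2 ^ n * (norm (F (Suc n) \<omega> - F n \<omega>))\<^sup>2)) \<partial>M) =
      (\<Sum>n. \<integral>\<^sup>+\<omega>. ennreal (2 ^ n * (norm (F (Suc n) \<omega> - F n \<omega>))\<^sup>2) \<partial>M)"
      by (rule nn_integral_suminf) simp
    also have "\<dots> \<le> (\<Sum>n. ennreal (4 * (1/2) ^ n))"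
      by (intro suminf_le * summableI)
    also have "\<dots> = ennreal (\<Sum>n. 4 * (1/2) ^ n)"
      by (intro suminf_ennreal2 summable_mult summable_geometric) auto
    also have "\<dots> < \<infinity>" by simp
    finally have "AE \<omega> in M. (\<Sum>n. ennreal (2 ^ n * (norm (F (Suc n) \<omega> - F n \<omega>))\<^sup>2)) \<noteq> \<infinity>"
      by (intro nn_integral_PInf_AE) auto
    then show ?thesis
    proof (eventually_elim)
      case (elim \<omega>)
      then have "summable (\<lambda>n. 2 ^ n * (norm (F (Suc n) \<omega> - F n \<omega>))\<^sup>2)"
        by (intro summable_suminf_not_top) auto
      then have "summable (\<lambda>n. 2 ^ n * (norm (F (Suc n) \<omega> - F n \<omega>))\<^sup>2 + (1/2) ^ n)"
        by (intro summable_add summable_geometric) auto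
      then have "summable (\<lambda>n. norm (F (Suc n) \<omega> - F n \<omega>))"
      proof (rule summable_comparison_test[rotated], intro exI allI impI)
        fix n
        have amgm: "a \<le> s * a\<^sup>2 + 1 / s" if "s > 0" "a \<ge> 0" for a s :: real
        proof -
          have "0 \<le> (s * a - 1)\<^sup>2" by simp
          then have "2 * (s * a) \<le> s * (s * a\<^sup>2) + 1" by (simp add: power2_eq_square algebra_simps)
          then have "s * a \<le> s * (s * a\<^sup>2) + 1" using that by (smt (verit) mult_nonneg_nonneg)
          then show ?thesis using that by (simp add: field_simps)
        qed
        show "norm (norm (F (Suc n) \<omega> - F n \<omega>)) \<le> 2 ^ n * (norm (F (Suc n) \<omega> - F n \<omega>))\<^sup>2 + (1/2) ^ n"
          using amgm[of "2 ^ n" "norm (F (Suc n) \<omega> - F n \<omega>)"] by (simp add: power_one_over)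
      qed
      then have "summable (\<lambda>n. F (Suc n) \<omega> - F n \<omega>)" by (rule summable_norm_cancel)
      then have "convergent (\<lambda>m. \<Sum>n<m. F (Suc n) \<omega> - F n \<omega>)"
        by (simp add: summable_iff_convergent)
      then have "convergent (\<lambda>m. F m \<omega> - F 0 \<omega>)" unfolding sum_lessThan_telescope[of "\<lambda>n. F n \<omega>"] .
      then have "convergent (\<lambda>m. (F m \<omega> - F 0 \<omega>) + F 0 \<omega>)"
        by (intro convergent_add convergent_const)
      then show ?case by simp
    qed
  qed
  let ?Y = "\<lambda>\<omega>. lim (\<lambda>n. F n \<omega>)"
  \<comment> \<open>Letting \<open>m\<close> tend to infinity in \<open>cauchy\<close>.
    Measurability of the limit is not yet known, so the integral is an \<open>nn_integral\<close>
    whose integrand is replaced a.e. by a liminf of measurable functions before Fatou is applied.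
    For \<open>m \<ge> n\<close> the bound \<open>2 * (\<delta> n + \<delta> m)\<close> is at most
    \<open>4 * \<delta> n\<close>.\<close>
  have fatou: "(\<integral>\<^sup>+\<omega>. ennreal ((norm (F n \<omega> - ?Y \<omega>))\<^sup>2) \<partial>M) \<le> ennreal (4 * \<delta> n)" for n
  proof -
    have "(\<integral>\<^sup>+\<omega>. ennreal ((norm (F n \<omega> - ?Y \<omega>))\<^sup>2) \<partial>M) =
        (\<integral>\<^sup>+\<omega>. liminf (\<lambda>m. ennreal ((norm (F n \<omega> - F m \<omega>))\<^sup>2)) \<partial>M)"
    proof (rule nn_integral_cong_AE, use conv in eventually_elim)
      case (elim \<omega>)
      then have "(\<lambda>m. F m \<omega>) \<longlonglongrightarrow> ?Y \<omega>" by (simp add: convergent_LIMSEQ_iff)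
      then have "(\<lambda>m. ennreal ((norm (F n \<omega> - F m \<omega>))\<^sup>2)) \<longlonglongrightarrow> ennreal ((norm (F n \<omega> - ?Y \<omega>))\<^sup>2)"
        by (intro tendsto_intros)
      then show ?case by (intro lim_imp_Liminf[symmetric]) auto
    qed
    also have "\<dots> \<le> liminf (\<lambda>m. \<integral>\<^sup>+\<omega>. ennreal ((norm (F n \<omega> - F m \<omega>))\<^sup>2) \<partial>M)"
      by (rule nn_integral_liminf) simp
    also have "\<dots> \<le> liminf (\<lambda>m. ennreal (4 * \<delta> n))"
    proof (rule Liminf_mono)
      show "\<forall>\<^sub>F m in sequentially. (\<integral>\<^sup>+\<omega>. ennreal ((norm (F n \<omega> - F m \<omega>))\<^sup>2) \<partial>M) \<le> ennreal (4 * \<delta> n)"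
        using eventually_ge_at_top[of n]
      proof eventually_elim
        case (elim m)
        then have "\<delta> m \<le> \<delta> n" unfolding \<delta>_def by (intro power_decreasing) auto
        then show ?case unfolding nn using cauchy[of n m] by (intro ennreal_leI) simp
      qed
    qed
    finally show ?thesis by (simp add: Liminf_const)
  qed
  have \<delta>0: "(\<lambda>n. 4 * \<delta> n) \<longlonglongrightarrow> 0" unfolding \<delta>_def
    by (intro tendsto_mult_right_zero LIMSEQ_power_zero) auto
  have "(\<lambda>n. \<integral>\<^sup>+\<omega>. ennreal ((norm (F n \<omega> - ?Y \<omega>))\<^sup>2) \<partial>M) \<longlonglongrightarrow> 0"
  proof (rule tendsto_sandwich[OF _ _ tendsto_const])
    show "(\<lambda>n. ennreal (4 * \<delta> n)) \<longlonglongrightarrow> 0"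
      using tendsto_ennrealI[OF \<delta>0] by simp
  qed (use fatou in auto)
  then have YC: "?Y \<in> C" by (rule lim_closed[OF FC conv])
  have YF: "(\<lambda>\<omega>. ?Y \<omega> - F n \<omega>) \<in> C" for n by (rule diff_closed[OF YC FC])
  have r_le: "(\<integral>\<omega>. (norm (?Y \<omega> - F n \<omega>))\<^sup>2 \<partial>M) \<le> 4 * \<delta> n" for n
  proof -
    have "ennreal (\<integral>\<omega>. (norm (?Y \<omega> - F n \<omega>))\<^sup>2 \<partial>M) \<le> ennreal (4 * \<delta> n)"
      using fatou[of n] nn_integral_eq_integral[OF square_integrable[OF YF[of n]]]
      by (simp add: norm_minus_commute)
    then show ?thesis by (simp add: \<delta>_def)
  qed
  have r: "(\<lambda>n. \<integral>\<omega>. (norm (?Y \<omega> - F n \<omega>))\<^sup>2 \<partial>M) \<longlonglongrightarrow> 0"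
    by (rule tendsto_sandwich[OF _ _ tendsto_const \<delta>0]) (use r_le in auto)
  \<comment> \<open>First variation, one-sided; the opposite inequality comes from
    \<open>- X\<close>. The perturbation starts at \<open>F n\<close>, since the limit need not lie
    in \<open>A\<close>; then \<open>n\<close> tends to infinity and finally \<open>t\<close> to
    0.\<close>
  have le0: "(\<integral>\<omega>. inner (Z \<omega> - ?Y \<omega>) (X \<omega>) \<partial>M) \<le> 0" if X: "X \<in> A" for X
  proof -
    let ?N = "\<integral>\<omega>. (norm (X \<omega>))\<^sup>2 \<partial>M" and ?i = "\<integral>\<omega>. inner (Z \<omega> - ?Y \<omega>) (X \<omega>) \<partial>M"
    have XC: "X \<in> C" using X A by auto
    have b: "?i \<le> t * ?N" if t: "t > 0" for t
    proof -
      \<comment> \<open>Of the five copies of \<open>\<delta> n\<close>, one is the gap between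
        \<open>q (F n)\<close> and the infimum \<open>d\<close>, and four bound the squared distance
        from \<open>F n\<close> to the limit. Each of the two estimates contributes one
        \<open>t^2 * ?N\<close>.\<close>
      have "2 * t * ?i \<le> 5 * \<delta> n + 2 * t\<^sup>2 * ?N" for n
      proof -
        have "d \<le> q (\<lambda>\<omega>. F n \<omega> + t *\<^sub>R X \<omega>)" by (rule d_le[OF A_lin[OF F(1) X]])
        also have "\<dots> = q (F n) - 2 * t * (\<integral>\<omega>. inner (Z \<omega> - F n \<omega>) (X \<omega>) \<partial>M) + t\<^sup>2 * ?N"
          using integral_norm_add_scaleR[OF ZF[of n] XC, of "-t"]
          by (simp add: q_def algebra_simps)
        finally have 1: "2 * t * (\<integral>\<omega>. inner (Z \<omega> - F n \<omega>) (X \<omega>) \<partial>M) \<le> \<delta> n + t\<^sup>2 * ?N"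
          using F(2)[of n] by simp
        have 2: "2 * (- t) * (\<integral>\<omega>. inner (?Y \<omega> - F n \<omega>) (X \<omega>) \<partial>M) \<le> 4 * \<delta> n + t\<^sup>2 * ?N"
          using two_integral_inner_le[OF YF[of n] XC, of "-t"] r_le[of n] by simp
        have "?i = (\<integral>\<omega>. inner (Z \<omega> - F n \<omega>) (X \<omega>) - inner (?Y \<omega> - F n \<omega>) (X \<omega>) \<partial>M)"
          by (simp add: inner_diff_left)
        also have "\<dots> = (\<integral>\<omega>. inner (Z \<omega> - F n \<omega>) (X \<omega>) \<partial>M) - (\<integral>\<omega>. inner (?Y \<omega> - F n \<omega>) (X \<omega>) \<partial>M)"
          by (intro Bochner_Integration.integral_diff inner_integrable ZF YF XC)
        finally have 3: "?i = \<dots>" .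
        show ?thesis unfolding 3 using 1 2 by (simp add: algebra_simps)
      qed
      moreover have "(\<lambda>n. 5 * \<delta> n + 2 * t\<^sup>2 * ?N) \<longlonglongrightarrow> 5 * 0 + 2 * t\<^sup>2 * ?N"
        unfolding \<delta>_def by (intro tendsto_intros LIMSEQ_power_zero) auto
      ultimately have "2 * t * ?i \<le> 5 * 0 + 2 * t\<^sup>2 * ?N"
        by (intro LIMSEQ_le_const) auto
      then have "t * ?i \<le> t * (t * ?N)" by (simp add: power2_eq_square)
      then show ?thesis using t by simp
    qed
    have "((\<lambda>t. t * ?N) \<longlongrightarrow> 0 * ?N) (at_right 0)" by (intro tendsto_intros)
    moreover have "\<forall>\<^sub>F t in at_right 0. ?i \<le> t * ?N"
      using eventually_at_right_less[of "0::real"] by eventually_elim (rule b)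
    ultimately have "?i \<le> 0 * ?N" by (intro tendsto_lowerbound) auto
    then show ?thesis by simp
  qed
  have "(\<integral>\<omega>. inner (Z \<omega> - ?Y \<omega>) (X \<omega>) \<partial>M) = 0" if X: "X \<in> A" for X
    using le0[OF X] le0[OF A_scale[OF X, of "-1"]] by simp
  then show ?thesis using that F(1) conv YC r by blast
qed

end

section \<open>Orthonormal bases of separable Hilbert spaces\<close>

text \<open>The vectors are not normalised and dependent ones are not discarded: a vector in the
  span of its predecessors becomes 0, and its coefficients vanish by the convention
  \<open>x / 0 = 0\<close>. This keeps the recursion total.\<close>

fun gram_schmidt :: "(nat \<Rightarrow> 'a::real_inner) \<Rightarrow> nat \<Rightarrow> 'a" where
  "gram_schmidt d n = d n - (\<Sum>i<n. (inner (d n) (gram_schmidt d i)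
     / inner (gram_schmidt d i) (gram_schmidt d i)) *\<^sub>R gram_schmidt d i)"

declare gram_schmidt.simps [simp del]

lemma gram_schmidt_orthogonal:
  "i < n \<Longrightarrow> inner (gram_schmidt d n) (gram_schmidt d i) = 0"
proof (induction n arbitrary: i rule: less_induct)
  case (less n)
  let ?b = "gram_schmidt d"
  have *: "inner (?b k) (?b i) = 0" if "k < n" "k \<noteq> i" for k
    using less.IH[of k i] less.IH[of i k] less.prems that by (metis inner_commute linorder_neqE_nat)
  \<comment> \<open>The term \<open>k = i\<close> also agrees when \<open>?b i = 0\<close>, both
    sides then being 0.\<close>
  have "(\<Sum>k<n. (inner (d n) (?b k) / inner (?b k) (?b k)) * inner (?b k) (?b i))
      = (\<Sum>k<n. if k = i then inner (d n) (?b i) else 0)"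
    by (rule sum.cong) (auto simp: *)
  also have "\<dots> = inner (d n) (?b i)" using less.prems by simp
  finally show ?case
    by (subst gram_schmidt.simps) (simp add: inner_diff_left inner_sum_left)
qed

lemma in_span_gram_schmidt: "d n \<in> span (range (gram_schmidt d))"
proof -
  have "d n = gram_schmidt d n + (\<Sum>i<n. (inner (d n) (gram_schmidt d i)
     / inner (gram_schmidt d i) (gram_schmidt d i)) *\<^sub>R gram_schmidt d i)"
    by (subst gram_schmidt.simps) simp
  also have "\<dots> \<in> span (range (gram_schmidt d))"
    by (intro span_add span_sum span_scale span_base) auto
  finally show ?thesis .
qed

text \<open>Gram-Schmidt is applied to an enumeration of a countable dense set; the span of the
  normalised nonzero outputs contains that set and is hence dense.\<close>

lemma orthonormal_basis_exists:
  "\<exists>B :: 'a::{real_inner,second_countable_topology} set.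
     (\<forall>e\<in>B. norm e = 1) \<and> pairwise orthogonal B \<and> closure (span B) = UNIV"
proof -
  obtain D :: "'a set" where D: "countable D" "D \<noteq> {}"
      "\<And>U. open U \<Longrightarrow> U \<noteq> {} \<Longrightarrow> \<exists>y\<in>D. y \<in> U"
    using countable_dense_exists by blast
  let ?b = "gram_schmidt (from_nat_into D)"
  define B where "B = sgn ` (range ?b - {0})"
  \<comment> \<open>The premise compares values instead of indices because \<open>B\<close> is a
    set: several indices may yield the vector 0.\<close>
  have orth: "inner (?b m) (?b n) = 0" if "?b m \<noteq> ?b n" for m n
    using gram_schmidt_orthogonal[of m n "from_nat_into D"] gram_schmidt_orthogonal[of n m "from_nat_into D"] that
    by (cases m n rule: linorder_cases) (auto simp: inner_commute)
  have "inner x y = 0" if xy: "x \<in> B" "y \<in> B" "x \<noteq> y" for x y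
  proof -
    obtain m n where "x = sgn (?b m)" "y = sgn (?b n)" using xy(1,2) unfolding B_def by blast
    moreover from this xy(3) have "?b m \<noteq> ?b n" by auto
    ultimately show ?thesis by (simp add: sgn_div_norm orth)
  qed
  then have "pairwise orthogonal B" by (auto simp: pairwise_def orthogonal_def)
  moreover have "\<forall>e\<in>B. norm e = 1" by (auto simp: B_def norm_sgn)
  moreover have "closure (span B) = UNIV"
  proof -
    have "b \<in> span B" if "b \<in> range ?b" for b
    proof (cases "b = 0")
      case False
      then have "b = norm b *\<^sub>R sgn b" by (simp add: sgn_div_norm)
      also have "\<dots> \<in> span B" unfolding B_def using that False by (intro span_scale span_base imageI) simp
      finally show ?thesis .
    qed (simp add: span_zero)
    then have "span (range ?b) \<subseteq> span B" by (intro span_minimal subsetI subspace_span)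
    then have "D \<subseteq> span B"
      using in_span_gram_schmidt[of "from_nat_into D"] from_nat_into_surj[OF D(1)] by blast
    moreover have "x \<in> closure D" for x
      unfolding closure_approachable using D(3)[of "ball x _"] by (auto simp: dist_commute)
    ultimately show ?thesis using closure_mono[of D "span B"] by blast
  qed
  ultimately show ?thesis by blast
qed

text \<open>Existence gives the \<open>SOME\<close> in \<open>onb\<close> its meaning; the chosen
  basis enters the development only through these three properties.\<close>

lemma
  shows norm_onb: "e \<in> (onb :: 'a::{real_inner,second_countable_topology} set) \<Longrightarrow> norm e = 1"
    and orthogonal_onb: "pairwise orthogonal (onb :: 'a set)"
    and closure_span_onb: "closure (span (onb :: 'a set)) = UNIV"
  using someI_ex[OF orthonormal_basis_exists[where 'a='a]] unfolding onb_def[symmetric] by blast+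

lemma inner_onb:
  "e \<in> (onb :: 'a::{real_inner,second_countable_topology} set) \<Longrightarrow> e' \<in> onb \<Longrightarrow>
    inner e e' = (if e = e' then 1 else 0)"
  using norm_onb[of e] orthogonal_onb[where 'a='a]
  by (auto simp: pairwise_def orthogonal_def norm_eq_1)

text \<open>Distinct basis vectors lie at distance \<open>sqrt 2\<close>, so the balls of radius 1/2
  around them are disjoint, and picking a point of a countable dense set in each ball is
  injective.\<close>

lemma countable_onb: "countable (onb :: 'a::{real_inner,second_countable_topology} set)"
proof -
  obtain D :: "'a set" where D: "countable D"
      "\<And>U. open U \<Longrightarrow> U \<noteq> {} \<Longrightarrow> \<exists>y\<in>D. y \<in> U"
    using countable_dense_exists by blast
  have "\<exists>y\<in>D. y \<in> ball e (1/2)" for e :: 'a by (rule D(2)) auto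
  then obtain h where h: "\<And>e::'a. h e \<in> D" "\<And>e. dist e (h e) < 1/2"
    by (metis mem_ball)
  have "inj_on h onb"
  proof (rule inj_onI, rule ccontr)
    fix e e' :: 'a assume e: "e \<in> onb" "e' \<in> onb" "h e = h e'" "e \<noteq> e'"
    have "(dist e e')\<^sup>2 = 2"
      using e by (simp add: dist_norm power2_norm_eq_inner inner_simps inner_onb)
    moreover have "dist e e' < 1" using h(2)[of e] h(2)[of e'] e(3) dist_triangle2[of e e' "h e"] by simp
    then have "(dist e e')\<^sup>2 < 1\<^sup>2" by (intro power_strict_mono) auto
    ultimately show False by simp
  qed
  moreover have "countable (h ` onb)" by (rule countable_subset[OF _ D(1)]) (use h(1) in auto)
  ultimately show ?thesis by (rule countable_image_inj_on[rotated])
qed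

text \<open>Best approximation: if \<open>y\<close>, a combination of finitely many basis vectors
  \<open>S\<close>, is close to \<open>x\<close>, then for every finite \<open>F\<close> containing
  \<open>S\<close> the partial sum over \<open>F\<close> is the orthogonal projection of
  \<open>x\<close> onto \<open>span F\<close>, and so at least as close as \<open>y\<close>.\<close>

lemma has_sum_onb:
  fixes x :: "'a::{real_inner,second_countable_topology}"
  shows "((\<lambda>e. inner x e *\<^sub>R e) has_sum x) onb"
  unfolding has_sum_def
proof (rule tendstoI)
  fix \<epsilon> :: real assume "\<epsilon> > 0"
  have "x \<in> closure (span onb)" by (simp add: closure_span_onb)
  then obtain y where y: "y \<in> span onb" "dist y x < \<epsilon>"
    using \<open>\<epsilon> > 0\<close> unfolding closure_approachable by blast
  then obtain S r where S: "finite S" "S \<subseteq> onb" "y = (\<Sum>e\<in>S. r e *\<^sub>R e)"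
    unfolding span_explicit by blast
  show "\<forall>\<^sub>F F in finite_subsets_at_top onb. dist (\<Sum>e\<in>F. inner x e *\<^sub>R e) x < \<epsilon>"
    unfolding eventually_finite_subsets_at_top
  proof (intro exI[of _ S] conjI allI impI S)
    fix F assume F: "finite F \<and> S \<subseteq> F \<and> F \<subseteq> onb"
    let ?p = "\<Sum>e\<in>F. inner x e *\<^sub>R e"
    have "orthogonal (x - ?p) e" if "e \<in> F" for e
    proof -
      have "inner ?p e = (\<Sum>e'\<in>F. if e' = e then inner x e else 0)"
        unfolding inner_sum_left using F that by (intro sum.cong) (auto simp: inner_onb subset_iff)
      also have "\<dots> = inner x e" using F that by simp
      finally show ?thesis by (simp add: orthogonal_def inner_diff_left)
    qed
    moreover have "?p - y \<in> span F"
      unfolding S(3) using F by (intro span_diff span_sum span_scale span_base) auto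
    ultimately have "orthogonal (x - ?p) (?p - y)" by (rule orthogonal_to_span[rotated])
    from norm_add_Pythagorean[OF this] have "(norm (x - ?p))\<^sup>2 \<le> (norm (x - y))\<^sup>2" by simp
    then have "norm (x - ?p) \<le> norm (x - y)" by simp
    then show "dist ?p x < \<epsilon>" using y(2) by (simp add: dist_norm norm_minus_commute)
  qed
qed

lemma has_sum_onb_bounded_linear:
  fixes x :: "'a::{real_inner,second_countable_topology}"
  assumes "bounded_linear T"
  shows "((\<lambda>e. inner x e *\<^sub>R T e) has_sum T x) onb"
proof -
  interpret bounded_linear T by fact
  show ?thesis using has_sum_bounded_linear[OF assms has_sum_onb[of x]] by (simp add: o_def scaleR)
qed

lemma parseval:
  fixes x y :: "'a::{real_inner,second_countable_topology}"
  shows "((\<lambda>e. inner x e * inner y e) has_sum inner x y) onb"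
  using has_sum_onb_bounded_linear[OF bounded_linear_inner_left[of y], of x]
  by (simp add: inner_commute)

section \<open>Measurability through countable orthonormal expansions\<close>

lemma filterlim_finite_exhaustion:
  assumes "countable B"
  obtains A :: "nat \<Rightarrow> 'a set" where "\<And>n. finite (A n)" "\<And>n. A n \<subseteq> B"
    "filterlim A (finite_subsets_at_top B) sequentially"
proof
  let ?A = "\<lambda>n. {x \<in> B. to_nat_on B x < n}"
  show "finite (?A n)" for n
  proof (rule inj_on_finite)
    show "inj_on (to_nat_on B) (?A n)"
      using inj_on_to_nat_on[OF assms] by (rule inj_on_subset) auto
    show "to_nat_on B ` ?A n \<subseteq> {..<n}" by auto
  qed auto
  show "?A n \<subseteq> B" for n by auto
  show "filterlim ?A (finite_subsets_at_top B) sequentially"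
    unfolding filterlim_iff eventually_finite_subsets_at_top
  proof (intro allI impI, elim exE conjE)
    fix P :: "'a set \<Rightarrow> bool" and X
    assume X: "finite X" "X \<subseteq> B" "\<forall>Y. finite Y \<and> X \<subseteq> Y \<and> Y \<subseteq> B \<longrightarrow> P Y"
    have "\<forall>\<^sub>F n in sequentially. \<forall>x\<in>X. to_nat_on B x < n"
      using X(1) by (simp add: eventually_ball_finite_distrib eventually_gt_at_top)
    then show "\<forall>\<^sub>F n in sequentially. P (?A n)"
    proof eventually_elim
      case (elim n)
      then show ?case using X(2) \<open>\<And>n. finite (?A n)\<close> by (intro X(3)[rule_format]) auto
    qed
  qed
qed

text \<open>An unordered sum over a countable set is a limit along initial segments of an
  enumeration, and pointwise limits of sequences preserve measurability.\<close>

lemma borel_measurable_has_sum: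
  fixes f :: "'i \<Rightarrow> 'w \<Rightarrow> 'b::{real_normed_vector,second_countable_topology}"
  assumes "countable B" "\<And>i. i \<in> B \<Longrightarrow> f i \<in> borel_measurable M"
    and "\<And>\<omega>. \<omega> \<in> space M \<Longrightarrow> ((\<lambda>i. f i \<omega>) has_sum g \<omega>) B"
  shows "g \<in> borel_measurable M"
proof -
  obtain A :: "nat \<Rightarrow> 'i set" where A: "\<And>n. finite (A n)" "\<And>n. A n \<subseteq> B"
    "filterlim A (finite_subsets_at_top B) sequentially"
    using filterlim_finite_exhaustion[OF assms(1)] by blast
  show ?thesis
  proof (rule borel_measurable_LIMSEQ_metric)
    show "(\<lambda>\<omega>. \<Sum>i\<in>A n. f i \<omega>) \<in> borel_measurable M" for n
      using A assms(2) by (intro borel_measurable_sum) auto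
    show "(\<lambda>n. \<Sum>i\<in>A n. f i \<omega>) \<longlonglongrightarrow> g \<omega>" if "\<omega> \<in> space M" for \<omega>
      using filterlim_compose[OF assms(3)[OF that, unfolded has_sum_def] A(3)] .
  qed
qed

text \<open>Pettis' theorem for separable Hilbert values: the basis expansion is a countable sum
  whose coefficients are the assumed measurable functions.\<close>

lemma borel_measurable_weak:
  fixes X :: "'w \<Rightarrow> 'b::{real_inner,second_countable_topology}"
  assumes [measurable]: "\<And>g. (\<lambda>\<omega>. inner (X \<omega>) g) \<in> borel_measurable M"
  shows "X \<in> borel_measurable M"
  by (rule borel_measurable_has_sum[OF countable_onb _ has_sum_onb]) measurable

section \<open>The Hilbert space of Hilbert-Schmidt operators\<close>

lemma hilbert_schmidt_inner_summable:
  fixes S T :: "'f::real_inner \<Rightarrow> 'g::real_inner"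
  assumes "hilbert_schmidt S" "hilbert_schmidt T"
  shows "(\<lambda>e. inner (S e) (T e)) summable_on onb"
proof (rule Infinite_Sum.abs_summable_summable,
    rule Infinite_Sum.abs_summable_on_comparison_test[where g="\<lambda>e. (norm (S e))\<^sup>2 + (norm (T e))\<^sup>2"])
  show "(\<lambda>e. norm ((norm (S e))\<^sup>2 + (norm (T e))\<^sup>2)) summable_on onb"
    using assms unfolding hilbert_schmidt_def by (simp add: summable_on_add)
  fix e
  have "2 * (norm (S e) * norm (T e)) \<le> (norm (S e))\<^sup>2 + (norm (T e))\<^sup>2"
    using sum_squares_bound[of "norm (S e)" "norm (T e)"] by (simp add: mult.assoc)
  moreover have "0 \<le> norm (S e) * norm (T e)" by simp
  ultimately show "norm (inner (S e) (T e)) \<le> norm ((norm (S e))\<^sup>2 + (norm (T e))\<^sup>2)"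
    using Cauchy_Schwarz_ineq2[of "S e" "T e"] by simp
qed

lemma has_sum_hs_inner:
  assumes "hilbert_schmidt S" "hilbert_schmidt T"
  shows "((\<lambda>e. inner (S e) (T e)) has_sum hs_inner S T) onb"
  unfolding hs_inner_def by (rule has_sum_infsum[OF hilbert_schmidt_inner_summable[OF assms]])

lemma hilbert_schmidt_lincomb:
  fixes S T :: "'f::real_inner \<Rightarrow> 'g::real_inner"
  assumes "hilbert_schmidt S" "hilbert_schmidt T"
  shows "hilbert_schmidt (\<lambda>x. S x + c *\<^sub>R T x)"
proof -
  have "(norm (S e + c *\<^sub>R T e))\<^sup>2 = (norm (S e))\<^sup>2 + (2 * c) * inner (S e) (T e) + c\<^sup>2 * (norm (T e))\<^sup>2" for e
    by (simp add: power2_norm_eq_inner inner_simps inner_commute algebra_simps power2_eq_square[of c])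
  then show ?thesis
    using assms hilbert_schmidt_inner_summable[OF assms] unfolding hilbert_schmidt_def
    by (simp add: bounded_linear_add bounded_linear_const_scaleR summable_on_add summable_on_cmult_right)
qed

lemma hilbert_schmidt_zero: "hilbert_schmidt (\<lambda>x. 0)"
  by (simp add: hilbert_schmidt_def)

text \<open>The predicate is turned into a type so that operators can serve as the values
  \<open>'k\<close> of \<open>L2_class\<close>. Its inner product and norm are
  \<open>hs_inner\<close> and \<open>hs_norm\<close> on representatives, so results transfer back by
  unfolding.\<close>

typedef (overloaded) ('f, 'g) hs_op =
  "{T :: 'f::{real_inner,second_countable_topology} \<Rightarrow> 'g::real_inner. hilbert_schmidt T}"
  morphisms hs_apply Abs_hs
  using hilbert_schmidt_zero by blast

lemma hilbert_schmidt_hs_apply [simp]: "hilbert_schmidt (hs_apply T)"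
  using hs_apply by blast

lemma hs_apply_Abs_hs: "hilbert_schmidt T \<Longrightarrow> hs_apply (Abs_hs T) = T"
  by (simp add: Abs_hs_inverse)

lemma bounded_linear_hs_apply: "bounded_linear (hs_apply T)"
  using hilbert_schmidt_hs_apply[of T] unfolding hilbert_schmidt_def by blast

instantiation hs_op :: ("{real_inner,second_countable_topology}", real_inner) real_inner
begin

definition zero_hs_op :: "('a, 'b) hs_op" where "zero_hs_op = Abs_hs (\<lambda>x. 0)"
definition plus_hs_op :: "('a, 'b) hs_op \<Rightarrow> ('a, 'b) hs_op \<Rightarrow> ('a, 'b) hs_op" where
  "plus_hs_op S T = Abs_hs (\<lambda>x. hs_apply S x + hs_apply T x)"
definition minus_hs_op :: "('a, 'b) hs_op \<Rightarrow> ('a, 'b) hs_op \<Rightarrow> ('a, 'b) hs_op" where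
  "minus_hs_op S T = Abs_hs (\<lambda>x. hs_apply S x - hs_apply T x)"
definition uminus_hs_op :: "('a, 'b) hs_op \<Rightarrow> ('a, 'b) hs_op" where
  "uminus_hs_op T = Abs_hs (\<lambda>x. - hs_apply T x)"
definition scaleR_hs_op :: "real \<Rightarrow> ('a, 'b) hs_op \<Rightarrow> ('a, 'b) hs_op" where
  "scaleR_hs_op c T = Abs_hs (\<lambda>x. c *\<^sub>R hs_apply T x)"
definition inner_hs_op :: "('a, 'b) hs_op \<Rightarrow> ('a, 'b) hs_op \<Rightarrow> real" where
  "inner_hs_op S T = hs_inner (hs_apply S) (hs_apply T)"
definition norm_hs_op :: "('a, 'b) hs_op \<Rightarrow> real" where
  "norm_hs_op T = hs_norm (hs_apply T)"
definition sgn_hs_op :: "('a, 'b) hs_op \<Rightarrow> ('a, 'b) hs_op" where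
  "sgn_hs_op T = inverse (norm T) *\<^sub>R T"
definition dist_hs_op :: "('a, 'b) hs_op \<Rightarrow> ('a, 'b) hs_op \<Rightarrow> real" where
  "dist_hs_op S T = norm (S - T)"
definition uniformity_hs_op :: "(('a, 'b) hs_op \<times> ('a, 'b) hs_op) filter" where
  "uniformity_hs_op = (INF e\<in>{0<..}. principal {(x, y). dist x y < e})"
definition open_hs_op :: "('a, 'b) hs_op set \<Rightarrow> bool" where
  "open_hs_op S = (\<forall>x\<in>S. \<forall>\<^sub>F (x', y) in uniformity. x' = x \<longrightarrow> y \<in> S)"

lemma hs_apply_zero: "hs_apply 0 x = 0"
  by (simp add: zero_hs_op_def hs_apply_Abs_hs hilbert_schmidt_zero)

lemma hs_apply_plus: "hs_apply (S + T) x = hs_apply S x + hs_apply T x"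
  using hilbert_schmidt_lincomb[of "hs_apply S" "hs_apply T" 1]
  by (simp add: plus_hs_op_def hs_apply_Abs_hs)

lemma hs_apply_minus: "hs_apply (S - T) x = hs_apply S x - hs_apply T x"
  using hilbert_schmidt_lincomb[of "hs_apply S" "hs_apply T" "-1"]
  by (simp add: minus_hs_op_def hs_apply_Abs_hs)

lemma hs_apply_scaleR: "hs_apply (c *\<^sub>R T) x = c *\<^sub>R hs_apply T x"
  using hilbert_schmidt_lincomb[OF hilbert_schmidt_zero, of "hs_apply T" c]
  by (simp add: scaleR_hs_op_def hs_apply_Abs_hs)

lemma hs_apply_uminus: "hs_apply (- T) x = - hs_apply T x"
  using hilbert_schmidt_lincomb[OF hilbert_schmidt_zero, of "hs_apply T" "-1"]
  by (simp add: uminus_hs_op_def hs_apply_Abs_hs)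

lemmas hs_apply_simps = hs_apply_zero hs_apply_plus hs_apply_minus hs_apply_scaleR hs_apply_uminus

lemma hs_op_eqI: "(\<And>x. hs_apply S x = hs_apply T x) \<Longrightarrow> S = T"
  by (simp add: fun_eq_iff flip: hs_apply_inject)

instance
proof
  fix R S T :: "('a, 'b) hs_op" and a b c :: real
  show "R + S + T = R + (S + T)" "R + S = S + R" "0 + R = R" "- R + R = 0" "R - S = R + - S"
    "a *\<^sub>R (R + S) = a *\<^sub>R R + a *\<^sub>R S" "(a + b) *\<^sub>R R = a *\<^sub>R R + b *\<^sub>R R"
    "a *\<^sub>R b *\<^sub>R R = (a * b) *\<^sub>R R" "1 *\<^sub>R R = R"
    by (rule hs_op_eqI, simp add: hs_apply_simps algebra_simps)+
  show "dist R S = norm (R - S)" by (rule dist_hs_op_def)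
  show "sgn R = inverse (norm R) *\<^sub>R R" by (rule sgn_hs_op_def)
  show "uniformity = (INF e\<in>{0<..}. principal {(x, y :: ('a, 'b) hs_op). dist x y < e})"
    by (rule uniformity_hs_op_def)
  show "open U = (\<forall>x\<in>U. \<forall>\<^sub>F (x', y) in uniformity. x' = x \<longrightarrow> y \<in> U)" for U :: "('a, 'b) hs_op set"
    by (rule open_hs_op_def)
  show "inner R S = inner S R" by (simp add: inner_hs_op_def hs_inner_def inner_commute)
  note sums = has_sum_hs_inner[OF hilbert_schmidt_hs_apply hilbert_schmidt_hs_apply]
  show "inner (R + S) T = inner R T + inner S T"
    unfolding inner_hs_op_def
    by (rule has_sum_unique[OF sums])
      (use has_sum_add[OF sums[of R T] sums[of S T]] in \<open>simp add: hs_apply_simps inner_add_left\<close>)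
  show "inner (a *\<^sub>R R) S = a * inner R S"
    unfolding inner_hs_op_def
    by (rule has_sum_unique[OF sums])
      (use has_sum_cmult_right[OF sums[of R S], of a] in \<open>simp add: hs_apply_simps\<close>)
  show "0 \<le> inner R R"
    unfolding inner_hs_op_def by (rule has_sum_nonneg[OF sums]) simp
  show "(inner R R = 0) = (R = 0)"
  proof
    assume 0: "inner R R = 0"
    \<comment> \<open>Nonnegative terms with sum 0 all vanish, so \<open>R\<close> is 0 on the
      basis; the expansion of \<open>R x\<close> along the basis then gives \<open>R x = 0\<close>
      for every \<open>x\<close>.\<close>
    have "inner (hs_apply R e) (hs_apply R e) = 0" if "e \<in> onb" for e
    proof (rule nonneg_infsum_le_0D[OF _ _ _ that])
      show "(\<Sum>\<^sub>\<infinity>e\<in>onb. inner (hs_apply R e) (hs_apply R e)) \<le> 0"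
        using 0 by (simp add: inner_hs_op_def hs_inner_def)
      show "(\<lambda>e. inner (hs_apply R e) (hs_apply R e)) summable_on onb"
        by (rule hilbert_schmidt_inner_summable) auto
    qed simp
    then have Re: "hs_apply R e = 0" if "e \<in> onb" for e using that by simp
    show "R = 0"
    proof (rule hs_op_eqI)
      fix x
      have "((\<lambda>e. 0) has_sum hs_apply R x) (onb :: 'a set)"
        using has_sum_onb_bounded_linear[OF bounded_linear_hs_apply, of x R]
        by (simp add: Re cong: has_sum_cong)
      then show "hs_apply R x = hs_apply 0 x"
        using has_sum_unique[OF has_sum_0_simp] by (metis hs_apply_zero)
    qed
  qed (simp add: inner_hs_op_def hs_inner_def hs_apply_simps)
  show "norm R = sqrt (inner R R)"
    by (simp add: norm_hs_op_def hs_norm_def inner_hs_op_def)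
qed

end

section \<open>Operator norm bound and completeness of the Hilbert-Schmidt norm\<close>

lemma norm_hs_op_power2_has_sum:
  "((\<lambda>e. (norm (hs_apply T e))\<^sup>2) has_sum (norm T)\<^sup>2) onb"
  using has_sum_hs_inner[of "hs_apply T" "hs_apply T"]
  unfolding power2_norm_eq_inner inner_hs_op_def by simp

lemma sum_norm_hs_apply_le:
  assumes "finite F" "F \<subseteq> onb"
  shows "(\<Sum>e\<in>F. (norm (hs_apply T e))\<^sup>2) \<le> (norm T)\<^sup>2"
  by (rule finite_sum_le_has_sum[OF norm_hs_op_power2_has_sum]) (use assms in auto)

text \<open>Cauchy-Schwarz on finite partial sums of the expansion of \<open>hs_apply T x\<close>,
  with Bessel's inequality for \<open>x\<close>, followed by passage to the limit.\<close>

lemma norm_hs_apply_le: "norm (hs_apply T x) \<le> norm T * norm x"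
proof -
  have "norm (\<Sum>e\<in>F. inner x e *\<^sub>R hs_apply T e) \<le> norm T * norm x" if F: "finite F" "F \<subseteq> onb" for F
  proof -
    have 1: "L2_set (\<lambda>e. norm (hs_apply T e)) F \<le> norm T"
      unfolding L2_set_def using sum_norm_hs_apply_le[OF F] by (intro real_le_lsqrt) (auto intro: sum_nonneg)
    have "(\<Sum>e\<in>F. inner x e * inner x e) \<le> inner x x"
      by (rule finite_sum_le_has_sum[OF parseval]) (use F in auto)
    then have "(\<Sum>e\<in>F. (inner x e)\<^sup>2) \<le> (norm x)\<^sup>2"
      unfolding power2_norm_eq_inner by (simp add: power2_eq_square)
    then have 2: "L2_set (inner x) F \<le> norm x"
      unfolding L2_set_def by (intro real_le_lsqrt) (auto intro: sum_nonneg)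
    have "norm (\<Sum>e\<in>F. inner x e *\<^sub>R hs_apply T e) \<le> (\<Sum>e\<in>F. \<bar>norm (hs_apply T e)\<bar> * \<bar>inner x e\<bar>)"
      by (rule order.trans[OF norm_sum]) (simp add: mult.commute)
    also have "\<dots> \<le> L2_set (\<lambda>e. norm (hs_apply T e)) F * L2_set (inner x) F"
      by (rule L2_set_mult_ineq)
    also have "\<dots> \<le> norm T * norm x"
      using 1 2 by (intro mult_mono) (auto simp: L2_set_def intro: sum_nonneg)
    finally show ?thesis .
  qed
  moreover have "((\<lambda>F. norm (\<Sum>e\<in>F. inner x e *\<^sub>R hs_apply T e)) \<longlongrightarrow> norm (hs_apply T x)) (finite_subsets_at_top onb)"
    using has_sum_onb_bounded_linear[OF bounded_linear_hs_apply] unfolding has_sum_def by (intro tendsto_norm)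
  ultimately show ?thesis
    using tendsto_upperbound[OF _ _ finite_subsets_at_top_neq_bot] eventually_finite_subsets_at_top_weakI
    by (metis (mono_tags, lifting))
qed

text \<open>A Cauchy sequence for the Hilbert-Schmidt norm is Cauchy for the operator norm, so a
  bounded limit \<open>L\<close> comes from completeness of bounded linear maps. It remains to show
  that \<open>L\<close> is Hilbert-Schmidt and that convergence holds in the stronger norm.\<close>

instance hs_op :: ("{real_inner,second_countable_topology}", "{real_inner,banach}") banach
proof
  fix X :: "nat \<Rightarrow> ('a, 'b) hs_op"
  assume X: "Cauchy X"
  let ?f = "\<lambda>n. Blinfun (hs_apply (X n))"
  have f: "blinfun_apply (?f n) = hs_apply (X n)" for n
    by (rule bounded_linear_Blinfun_apply[OF bounded_linear_hs_apply])
  have "dist (?f n) (?f m) \<le> dist (X n) (X m)" for n m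
    unfolding dist_norm
    by (rule norm_blinfun_bound)
      (auto simp: blinfun.diff_left f hs_apply_minus[symmetric] intro: norm_hs_apply_le)
  with X have "Cauchy ?f" unfolding Cauchy_def by (meson order.strict_trans1)
  then obtain L where L: "?f \<longlonglongrightarrow> L" using Cauchy_convergent convergentD by blast
  have XL: "(\<lambda>n. hs_apply (X n) x) \<longlonglongrightarrow> L x" for x
    using blinfun.tendsto[OF L tendsto_const] by (simp add: f)
  \<comment> \<open>In a finite partial sum the limit over \<open>m\<close> may be taken term by
    term; the index \<open>N\<close> and the bound do not depend on the finite set, so the estimate
    survives on the whole basis.\<close>
  have bound: "\<exists>N. \<forall>n\<ge>N. \<forall>F. finite F \<and> F \<subseteq> onb \<longrightarrow> (\<Sum>e\<in>F. (norm (hs_apply (X n) e - L e))\<^sup>2) \<le> \<epsilon>\<^sup>2"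
    if "\<epsilon> > 0" for \<epsilon>
  proof -
    obtain N where N: "\<And>m n. m \<ge> N \<Longrightarrow> n \<ge> N \<Longrightarrow> norm (X n - X m) < \<epsilon>"
      using X \<open>\<epsilon> > 0\<close> unfolding Cauchy_def dist_norm by blast
    have "(\<Sum>e\<in>F. (norm (hs_apply (X n) e - L e))\<^sup>2) \<le> \<epsilon>\<^sup>2" if n: "n \<ge> N" and F: "finite F" "F \<subseteq> onb" for n F
    proof (rule LIMSEQ_le_const2)
      show "(\<lambda>m. \<Sum>e\<in>F. (norm (hs_apply (X n) e - hs_apply (X m) e))\<^sup>2) \<longlonglongrightarrow> (\<Sum>e\<in>F. (norm (hs_apply (X n) e - L e))\<^sup>2)"
        by (intro tendsto_intros XL)
      have "(\<Sum>e\<in>F. (norm (hs_apply (X n) e - hs_apply (X m) e))\<^sup>2) \<le> \<epsilon>\<^sup>2" if "m \<ge> N" for m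
      proof -
        have "(\<Sum>e\<in>F. (norm (hs_apply (X n) e - hs_apply (X m) e))\<^sup>2) \<le> (norm (X n - X m))\<^sup>2"
          using sum_norm_hs_apply_le[OF F, of "X n - X m"] by (simp add: hs_apply_minus)
        also have "\<dots> \<le> \<epsilon>\<^sup>2" using N[OF that n] by (intro power_mono) auto
        finally show ?thesis .
      qed
      then show "\<exists>N. \<forall>m\<ge>N. (\<Sum>e\<in>F. (norm (hs_apply (X n) e - hs_apply (X m) e))\<^sup>2) \<le> \<epsilon>\<^sup>2" by blast
    qed
    then show ?thesis by blast
  qed
  have HS: "hilbert_schmidt (\<lambda>x. hs_apply (X n) x - L x)"
    if "\<forall>F. finite F \<and> F \<subseteq> onb \<longrightarrow> (\<Sum>e\<in>F. (norm (hs_apply (X n) e - L e))\<^sup>2) \<le> K" for n K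
    unfolding hilbert_schmidt_def
    by (intro conjI bounded_linear_sub bounded_linear_hs_apply blinfun.bounded_linear_right
        nonneg_bdd_above_summable_on bdd_aboveI[of _ K]) (use that in auto)
  \<comment> \<open>One index with any finite bound suffices: \<open>L\<close> is the difference of
    \<open>X N\<close> and \<open>X N - L\<close>, both Hilbert-Schmidt.\<close>
  obtain N where "\<forall>F. finite F \<and> F \<subseteq> onb \<longrightarrow> (\<Sum>e\<in>F. (norm (hs_apply (X N) e - L e))\<^sup>2) \<le> 1\<^sup>2"
    using bound[of 1] by auto
  from hilbert_schmidt_lincomb[OF hilbert_schmidt_hs_apply[of "X N"] HS[OF this], of "-1"]
  have "hilbert_schmidt (blinfun_apply L)" by simp
  then obtain T where T: "hs_apply T = blinfun_apply L" using hs_apply_Abs_hs by blast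
  have "X \<longlonglongrightarrow> T"
  proof (rule LIMSEQ_I)
    fix r :: real assume "r > 0"
    then obtain N where N: "\<forall>n\<ge>N. \<forall>F. finite F \<and> F \<subseteq> onb \<longrightarrow> (\<Sum>e\<in>F. (norm (hs_apply (X n) e - L e))\<^sup>2) \<le> (r/2)\<^sup>2"
      using bound[of "r/2"] by auto
    have "norm (X n - T) < r" if "n \<ge> N" for n
    proof -
      have "(norm (X n - T))\<^sup>2 \<le> (r/2)\<^sup>2"
        by (rule has_sum_le_finite_sums[OF norm_hs_op_power2_has_sum])
          (use N that in \<open>auto simp: hs_apply_minus T\<close>)
      then have "norm (X n - T) \<le> r/2" by (rule power2_le_imp_le) (use \<open>r > 0\<close> in simp)
      then show ?thesis using \<open>r > 0\<close> by simp
    qed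
    then show "\<exists>N. \<forall>n\<ge>N. norm (X n - T) < r" by blast
  qed
  then show "convergent X" by (rule convergentI)
qed

lemma hilbert_schmidt_tensor:
  fixes f :: "'f::{real_inner,second_countable_topology}" and g :: "'g::real_inner"
  shows "hilbert_schmidt (tensor g f)"
proof -
  have "bounded_linear (\<lambda>x. inner f x *\<^sub>R g)"
    using bounded_linear_compose[OF bounded_linear_scaleR_left bounded_linear_inner_right] .
  moreover have "(\<lambda>e. (norm g)\<^sup>2 * (inner f e * inner f e)) summable_on onb"
    by (rule summable_on_cmult_right[OF has_sum_imp_summable[OF parseval]])
  ultimately show ?thesis
    unfolding hilbert_schmidt_def tensor_def
    by (simp add: power_mult_distrib power2_eq_square algebra_simps)
qed

text \<open>Expand \<open>f\<close> in the basis and apply the bounded functional sending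
  \<open>x\<close> to \<open>inner (T x) g\<close>. Rank-one test operators thus recover the values
  of an operator.\<close>

lemma hs_inner_tensor:
  fixes T :: "'f::{real_inner,second_countable_topology} \<Rightarrow> 'g::real_inner"
  assumes "hilbert_schmidt T"
  shows "hs_inner T (tensor g f) = inner (T f) g"
proof -
  have "bounded_linear (\<lambda>x. inner (T x) g)"
    using assms bounded_linear_compose[OF bounded_linear_inner_left] unfolding hilbert_schmidt_def by blast
  from has_sum_onb_bounded_linear[OF this, of f]
  show ?thesis unfolding hs_inner_def tensor_def by (intro infsumI) simp
qed

section \<open>Linear conditional expectation\<close>

lemma norm_diff_power2_le: "(norm (x - y))\<^sup>2 \<le> 2 * (norm x)\<^sup>2 + 2 * (norm y)\<^sup>2"
  for x y :: "'a::real_normed_vector"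
proof -
  have "(norm (x - y))\<^sup>2 \<le> (norm x + norm y)\<^sup>2"
    by (intro power_mono norm_triangle_ineq4 norm_ge_zero)
  also have "\<dots> \<le> 2 * (norm x)\<^sup>2 + 2 * (norm y)\<^sup>2"
    using sum_squares_bound[of "norm x" "norm y"] by (simp add: power2_sum)
  finally show ?thesis .
qed

lemma integrable_norm_power2_diff:
  fixes X Y :: "'w \<Rightarrow> 'k::real_normed_vector"
  assumes "integrable M (\<lambda>\<omega>. (norm (X \<omega>))\<^sup>2)" "integrable M (\<lambda>\<omega>. (norm (Y \<omega>))\<^sup>2)"
    and "(\<lambda>\<omega>. (norm (X \<omega> - Y \<omega>))\<^sup>2) \<in> borel_measurable M"
  shows "integrable M (\<lambda>\<omega>. (norm (X \<omega> - Y \<omega>))\<^sup>2)"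
proof (rule Bochner_Integration.integrable_bound[OF _ assms(3)])
  show "integrable M (\<lambda>\<omega>. 2 * (norm (X \<omega>))\<^sup>2 + 2 * (norm (Y \<omega>))\<^sup>2)" using assms by simp
  show "AE \<omega> in M. norm ((norm (X \<omega> - Y \<omega>))\<^sup>2) \<le> norm (2 * (norm (X \<omega>))\<^sup>2 + 2 * (norm (Y \<omega>))\<^sup>2)"
    using norm_diff_power2_le by auto
qed

text \<open>Some \<open>F n\<close> has finite L2 distance to \<open>Y\<close>, and \<open>Y\<close>
  is \<open>F n\<close> minus that difference. Measurability is asked of real-valued norms only, so
  that the lemma also covers \<open>hs_op\<close>.\<close>

lemma integrable_norm_power2_lim:
  fixes F :: "nat \<Rightarrow> 'w \<Rightarrow> 'k::real_normed_vector"
  assumes int: "\<And>n. integrable M (\<lambda>\<omega>. (norm (F n \<omega>))\<^sup>2)"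
    and lim: "(\<lambda>n. \<integral>\<^sup>+\<omega>. ennreal ((norm (F n \<omega> - Y \<omega>))\<^sup>2) \<partial>M) \<longlonglongrightarrow> 0"
    and meas: "\<And>n. (\<lambda>\<omega>. (norm (F n \<omega> - Y \<omega>))\<^sup>2) \<in> borel_measurable M"
      "(\<lambda>\<omega>. (norm (Y \<omega>))\<^sup>2) \<in> borel_measurable M"
  shows "integrable M (\<lambda>\<omega>. (norm (Y \<omega>))\<^sup>2)"
proof -
  have "\<forall>\<^sub>F n in sequentially. (\<integral>\<^sup>+\<omega>. ennreal ((norm (F n \<omega> - Y \<omega>))\<^sup>2) \<partial>M) < 1"
    by (rule order_tendstoD(2)[OF lim]) simp
  then obtain n where n: "(\<integral>\<^sup>+\<omega>. ennreal ((norm (F n \<omega> - Y \<omega>))\<^sup>2) \<partial>M) < 1"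
    by (auto simp: eventually_sequentially)
  have "integrable M (\<lambda>\<omega>. (norm (F n \<omega> - Y \<omega>))\<^sup>2)"
    by (rule integrableI_bounded[OF meas(1)])
      (use n in \<open>auto intro: less_trans simp: less_top[symmetric]\<close>)
  then show ?thesis
    using integrable_norm_power2_diff[OF int[of n], of "\<lambda>\<omega>. F n \<omega> - Y \<omega>"] meas(2) by simp
qed

interpretation L2: L2_class M "{X :: 'w \<Rightarrow> 'k::{real_inner,banach,second_countable_topology}. L2 M X}"
  for M :: "'w measure"
proof
  show "(\<lambda>\<omega>. X \<omega> + c *\<^sub>R Y \<omega>) \<in> {X. L2 M X}" if "X \<in> {X. L2 M X}" "Y \<in> {X. L2 M X}"
    for X Y :: "'w \<Rightarrow> 'k" and c
  proof -
    have [measurable]: "X \<in> borel_measurable M" "Y \<in> borel_measurable M"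
      and "integrable M (\<lambda>\<omega>. (norm (X \<omega>))\<^sup>2)" "integrable M (\<lambda>\<omega>. (norm (Y \<omega>))\<^sup>2)"
      using that by (auto simp: L2_def)
    then show ?thesis
      using integrable_norm_power2_diff[of M X "\<lambda>\<omega>. (- c) *\<^sub>R Y \<omega>"]
      by (simp add: L2_def power_mult_distrib)
  qed
  fix F :: "nat \<Rightarrow> 'w \<Rightarrow> 'k"
  assume F: "\<And>n. F n \<in> {X. L2 M X}"
    and lim: "(\<lambda>n. \<integral>\<^sup>+\<omega>. ennreal ((norm (F n \<omega> - lim (\<lambda>m. F m \<omega>)))\<^sup>2) \<partial>M) \<longlonglongrightarrow> 0"
  have [measurable]: "F n \<in> borel_measurable M" for n using F by (auto simp: L2_def)
  show "(\<lambda>\<omega>. lim (\<lambda>n. F n \<omega>)) \<in> {X. L2 M X}"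
    using integrable_norm_power2_lim[OF _ lim] F by (simp add: L2_def)
qed (auto simp: L2_def)

lemma bounded_affine_lincomb:
  assumes "bounded_affine \<gamma>" "bounded_affine \<gamma>'"
  shows "bounded_affine (\<lambda>v. \<gamma> v + c *\<^sub>R \<gamma>' v)"
proof -
  obtain L a L' a' where L: "bounded_linear L" "\<And>x. \<gamma> x = L x + a" "bounded_linear L'" "\<And>x. \<gamma>' x = L' x + a'"
    using assms unfolding bounded_affine_def by metis
  have "bounded_linear (\<lambda>x. L x + c *\<^sub>R L' x)"
    by (intro bounded_linear_add bounded_linear_const_scaleR L)
  then show ?thesis unfolding bounded_affine_def
    by (intro exI[of _ "\<lambda>x. L x + c *\<^sub>R L' x"] exI[of _ "a + c *\<^sub>R a'"]) (simp add: L algebra_simps)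
qed

lemma bounded_affine_const: "bounded_affine (\<lambda>v. a)"
  unfolding bounded_affine_def by (intro exI[of _ "\<lambda>v. 0"] exI[of _ a]) simp

lemma bounded_affine_compose_linear:
  assumes T: "bounded_linear T" and "bounded_affine \<gamma>"
  shows "bounded_affine (\<lambda>v. T (\<gamma> v) + a)"
proof -
  obtain L c where L: "bounded_linear L" "\<And>x. \<gamma> x = L x + c"
    using assms(2) unfolding bounded_affine_def by blast
  show ?thesis unfolding bounded_affine_def
    using bounded_linear_compose[OF T L(1)] linear_add[OF bounded_linear.linear[OF T]] by (auto simp: L(2) add.assoc)
qed

lemma bounded_affine_continuous_on: "bounded_affine \<gamma> \<Longrightarrow> continuous_on S \<gamma>"
proof -
  assume "bounded_affine \<gamma>"
  then obtain L a where L: "bounded_linear L" "\<gamma> = (\<lambda>x. L x + a)"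
    unfolding bounded_affine_def by blast
  show ?thesis unfolding L(2) by (intro continuous_intros bounded_linear.continuous_on[OF L(1)])
qed

text \<open>Affine growth: \<open>|L v + a|^2\<close> is at most
  \<open>2 * K^2 * |v|^2 + 2 * |a|^2\<close>, and constants are integrable for a finite measure. The
  general target sort serves vectors and \<open>hs_op\<close> alike, as
  \<open>|\<gamma> v|^2\<close> is a continuous real function of \<open>v\<close>.\<close>

lemma integrable_norm_power2_bounded_affine:
  fixes V :: "'w \<Rightarrow> 'h::{real_normed_vector,second_countable_topology}"
    and \<gamma> :: "'h \<Rightarrow> 'k::real_normed_vector"
  assumes "finite_measure M" "L2 M V" "bounded_affine \<gamma>"
  shows "integrable M (\<lambda>\<omega>. (norm (\<gamma> (V \<omega>)))\<^sup>2)"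
proof -
  interpret finite_measure M by fact
  obtain L a where L: "bounded_linear L" "\<And>x. \<gamma> x = L x + a"
    using assms(3) unfolding bounded_affine_def by blast
  obtain K where K: "\<And>x. norm (L x) \<le> norm x * K" using bounded_linear.bounded[OF L(1)] by blast
  have "continuous_on UNIV (\<lambda>v. (norm (\<gamma> v))\<^sup>2)"
    by (intro continuous_intros bounded_affine_continuous_on assms)
  then have "(\<lambda>v. (norm (\<gamma> v))\<^sup>2) \<in> borel_measurable borel" by (rule borel_measurable_continuous_onI)
  then have meas: "(\<lambda>\<omega>. (norm (\<gamma> (V \<omega>)))\<^sup>2) \<in> borel_measurable M"
    using assms(2) unfolding L2_def by (auto intro: measurable_compose)
  show ?thesis
  proof (rule Bochner_Integration.integrable_bound[OF _ meas])
    show "integrable M (\<lambda>\<omega>. 2 * (K\<^sup>2 * (norm (V \<omega>))\<^sup>2) + 2 * (norm a)\<^sup>2)"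
      using assms(2) unfolding L2_def by simp
    have "(norm (\<gamma> v))\<^sup>2 \<le> 2 * (K\<^sup>2 * (norm v)\<^sup>2) + 2 * (norm a)\<^sup>2" for v
    proof -
      have "(norm (L v))\<^sup>2 \<le> (norm v * K)\<^sup>2" by (intro power_mono K) simp
      then show ?thesis
        using norm_diff_power2_le[of "L v" "-a"] by (simp add: L power_mult_distrib mult.commute)
    qed
    then show "AE \<omega> in M. norm ((norm (\<gamma> (V \<omega>)))\<^sup>2) \<le> norm (2 * (K\<^sup>2 * (norm (V \<omega>))\<^sup>2) + 2 * (norm a)\<^sup>2)"
      by (intro always_eventually allI) (smt (verit) real_norm_def zero_le_power2)
  qed
qed

lemma L2_bounded_affine:
  fixes V :: "'w \<Rightarrow> 'h::{real_normed_vector,second_countable_topology}"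
  assumes "finite_measure M" "L2 M V" "bounded_affine \<gamma>"
  shows "L2 M (\<lambda>\<omega>. \<gamma> (V \<omega>))"
  unfolding L2_def
proof
  show "(\<lambda>\<omega>. \<gamma> (V \<omega>)) \<in> borel_measurable M"
    using assms(2) borel_measurable_continuous_onI[OF bounded_affine_continuous_on[OF assms(3)]]
    unfolding L2_def by (auto intro: measurable_compose)
qed (rule integrable_norm_power2_bounded_affine[OF assms])

lemma lincomb_bounded_affine_compose:
  assumes "X \<in> {\<lambda>\<omega>. \<gamma> (V \<omega>) |\<gamma>. bounded_affine \<gamma>}" "Y \<in> {\<lambda>\<omega>. \<gamma> (V \<omega>) |\<gamma>. bounded_affine \<gamma>}"
  shows "(\<lambda>\<omega>. X \<omega> + c *\<^sub>R Y \<omega>) \<in> {\<lambda>\<omega>. \<gamma> (V \<omega>) |\<gamma>. bounded_affine \<gamma>}"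
proof -
  obtain \<gamma> \<gamma>' where *: "X = (\<lambda>\<omega>. \<gamma> (V \<omega>))" "bounded_affine \<gamma>" "Y = (\<lambda>\<omega>. \<gamma>' (V \<omega>))" "bounded_affine \<gamma>'"
    using assms by auto
  show ?thesis
    unfolding mem_Collect_eq
    by (rule exI[of _ "\<lambda>v. \<gamma> v + c *\<^sub>R \<gamma>' v"]) (simp add: * bounded_affine_lincomb)
qed

text \<open>Differences of \<open>Y\<close> and bounded affine functions of \<open>V\<close> are
  square-integrable as soon as \<open>Y\<close> is, so membership takes exactly the form of the
  approximation hypothesis in \<open>orthogonal_closure\<close>.\<close>

lemma aff_closure_iff:
  fixes V :: "'w \<Rightarrow> 'h::{real_normed_vector,second_countable_topology}"
    and Y :: "'w \<Rightarrow> 'k::{real_inner,banach,second_countable_topology}"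
  assumes "finite_measure M" "L2 M V"
  shows "Y \<in> aff_closure M V \<longleftrightarrow> L2 M Y \<and>
    (\<forall>\<epsilon>>0. \<exists>X\<in>{\<lambda>\<omega>. \<gamma> (V \<omega>) |\<gamma>. bounded_affine \<gamma>}. (\<integral>\<omega>. (norm (Y \<omega> - X \<omega>))\<^sup>2 \<partial>M) < \<epsilon>)"
proof -
  have "integrable M (\<lambda>\<omega>. (norm (Y \<omega> - \<gamma> (V \<omega>)))\<^sup>2)" if "L2 M Y" "bounded_affine \<gamma>" for \<gamma>
    using L2.square_integrable L2.diff_closed[of Y M] L2_bounded_affine[OF assms] that by blast
  then have "(\<exists>\<gamma>. bounded_affine \<gamma> \<and> integrable M (\<lambda>\<omega>. (norm (Y \<omega> - \<gamma> (V \<omega>)))\<^sup>2) \<and>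
      (\<integral>\<omega>. (norm (Y \<omega> - \<gamma> (V \<omega>)))\<^sup>2 \<partial>M) < \<epsilon>) \<longleftrightarrow>
    (\<exists>X\<in>{\<lambda>\<omega>. \<gamma> (V \<omega>) |\<gamma>. bounded_affine \<gamma>}. (\<integral>\<omega>. (norm (Y \<omega> - X \<omega>))\<^sup>2 \<partial>M) < \<epsilon>)"
    if "L2 M Y" for \<epsilon> using that by auto
  then show ?thesis unfolding aff_closure_def by (simp cong: conj_cong)
qed

text \<open>The limit from \<open>projection_sequence\<close> witnesses the \<open>SOME\<close>: its
  approximants put it into the closure, and orthogonality extends from affine functions of
  \<open>V\<close> to their closure.\<close>

lemma lin_cond_exp_spec:
  fixes V :: "'w \<Rightarrow> 'h::{real_normed_vector,second_countable_topology}"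
    and Z :: "'w \<Rightarrow> 'k::{real_inner,banach,second_countable_topology}"
  assumes "finite_measure M" "L2 M V" "L2 M Z"
  shows "lin_cond_exp M V Z \<in> aff_closure M V"
    and "X \<in> aff_closure M V \<Longrightarrow> (\<integral>\<omega>. inner (Z \<omega> - lin_cond_exp M V Z \<omega>) (X \<omega>) \<partial>M) = 0"
proof -
  let ?A = "{\<lambda>\<omega>. \<gamma> (V \<omega>) |\<gamma>. bounded_affine \<gamma>} :: ('w \<Rightarrow> 'k) set"
  have A: "?A \<subseteq> {X. L2 M X}" using L2_bounded_affine[OF assms(1,2)] by auto
  have ne: "?A \<noteq> {}" using bounded_affine_const by blast
  obtain F where F: "\<And>n. F n \<in> ?A" "(\<lambda>\<omega>. lim (\<lambda>n. F n \<omega>)) \<in> {X. L2 M X}"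
    "(\<lambda>n. \<integral>\<omega>. (norm (lim (\<lambda>m. F m \<omega>) - F n \<omega>))\<^sup>2 \<partial>M) \<longlonglongrightarrow> 0"
    "\<And>X. X \<in> ?A \<Longrightarrow> (\<integral>\<omega>. inner (Z \<omega> - lim (\<lambda>n. F n \<omega>)) (X \<omega>) \<partial>M) = 0"
    by (rule L2.projection_sequence[OF A ne lincomb_bounded_affine_compose, of Z])
      (use assms(3) in auto)
  let ?Y = "\<lambda>\<omega>. lim (\<lambda>n. F n \<omega>)"
  have "\<exists>X\<in>?A. (\<integral>\<omega>. (norm (?Y \<omega> - X \<omega>))\<^sup>2 \<partial>M) < \<epsilon>" if "\<epsilon> > 0" for \<epsilon>
    using eventually_happens'[OF sequentially_bot order_tendstoD(2)[OF F(3) that]] F(1) by blast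
  then have Y: "?Y \<in> aff_closure M V" using F(2) by (simp add: aff_closure_iff[OF assms(1,2)])
  moreover have "(\<integral>\<omega>. inner (Z \<omega> - ?Y \<omega>) (X \<omega>) \<partial>M) = 0" if X: "X \<in> aff_closure M V" for X
  proof (rule L2.orthogonal_closure[OF _ A F(4)])
    show "(\<lambda>\<omega>. Z \<omega> - ?Y \<omega>) \<in> {X. L2 M X}" by (rule L2.diff_closed) (use assms(3) F(2) in auto)
  qed (use X in \<open>auto simp: aff_closure_iff[OF assms(1,2)]\<close>)
  ultimately have "\<exists>Y. Y \<in> aff_closure M V \<and> (\<forall>X\<in>aff_closure M V. (\<integral>\<omega>. inner (Z \<omega> - Y \<omega>) (X \<omega>) \<partial>M) = 0)"
    by blast
  from someI_ex[OF this, folded lin_cond_exp_def]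
  show "lin_cond_exp M V Z \<in> aff_closure M V"
    and "X \<in> aff_closure M V \<Longrightarrow> (\<integral>\<omega>. inner (Z \<omega> - lin_cond_exp M V Z \<omega>) (X \<omega>) \<partial>M) = 0"
    by blast+
qed

section \<open>Square-integrable Hilbert-Schmidt operators\<close>

text \<open>\<open>L2_hs\<close> guarantees Hilbert-Schmidt values only on \<open>space M\<close>,
  so lifting a function through \<open>Abs_hs\<close> reproduces it only there.\<close>

lemma L2_hs_cong:
  assumes "\<And>\<omega>. \<omega> \<in> space M \<Longrightarrow> Y \<omega> = Y' \<omega>"
  shows "L2_hs M Y \<longleftrightarrow> L2_hs M Y'"
proof -
  have "(\<lambda>\<omega>. inner (Y \<omega> f) g) \<in> borel_measurable M \<longleftrightarrow> (\<lambda>\<omega>. inner (Y' \<omega> f) g) \<in> borel_measurable M" for f g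
    by (rule measurable_cong) (simp add: assms)
  moreover have "integrable M (\<lambda>\<omega>. (hs_norm (Y \<omega>))\<^sup>2) \<longleftrightarrow> integrable M (\<lambda>\<omega>. (hs_norm (Y' \<omega>))\<^sup>2)"
    by (rule Bochner_Integration.integrable_cong) (simp_all add: assms)
  ultimately show ?thesis unfolding L2_hs_def using assms by simp
qed

lemma L2_hs_hs_apply_iff:
  "L2_hs M (\<lambda>\<omega>. hs_apply (X \<omega>)) \<longleftrightarrow>
    (\<forall>f g. (\<lambda>\<omega>. inner (hs_apply (X \<omega>) f) g) \<in> borel_measurable M) \<and> integrable M (\<lambda>\<omega>. (norm (X \<omega>))\<^sup>2)"
  by (simp add: L2_hs_def norm_hs_op_def)

text \<open>The inner product is a countable sum over the basis of \<open>inner (X e) (Y e)\<close>,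
  and each \<open>X e\<close>, \<open>Y e\<close> is Borel measurable by
  \<open>borel_measurable_weak\<close>.\<close>

lemma borel_measurable_inner_hs_op:
  fixes X Y :: "'w \<Rightarrow> ('f::{real_inner,second_countable_topology}, 'g::{real_inner,second_countable_topology}) hs_op"
  assumes "\<And>f g. (\<lambda>\<omega>. inner (hs_apply (X \<omega>) f) g) \<in> borel_measurable M"
    and "\<And>f g. (\<lambda>\<omega>. inner (hs_apply (Y \<omega>) f) g) \<in> borel_measurable M"
  shows "(\<lambda>\<omega>. inner (X \<omega>) (Y \<omega>)) \<in> borel_measurable M"
proof (rule borel_measurable_has_sum[OF countable_onb])
  show "((\<lambda>e. inner (hs_apply (X \<omega>) e) (hs_apply (Y \<omega>) e)) has_sum inner (X \<omega>) (Y \<omega>)) onb" for \<omega>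
    unfolding inner_hs_op_def by (rule has_sum_hs_inner) simp_all
  have [measurable]: "(\<lambda>\<omega>. hs_apply (X \<omega>) e) \<in> borel_measurable M" "(\<lambda>\<omega>. hs_apply (Y \<omega>) e) \<in> borel_measurable M" for e
    by (rule borel_measurable_weak, rule assms)+
  show "(\<lambda>\<omega>. inner (hs_apply (X \<omega>) e) (hs_apply (Y \<omega>) e)) \<in> borel_measurable M" for e
    by measurable
qed

lemma borel_measurable_norm_hs_op:
  fixes X :: "'w \<Rightarrow> ('f::{real_inner,second_countable_topology}, 'g::{real_inner,second_countable_topology}) hs_op"
  assumes "\<And>f g. (\<lambda>\<omega>. inner (hs_apply (X \<omega>) f) g) \<in> borel_measurable M"
  shows "(\<lambda>\<omega>. norm (X \<omega>)) \<in> borel_measurable M"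
proof -
  have [measurable]: "(\<lambda>\<omega>. inner (X \<omega>) (X \<omega>)) \<in> borel_measurable M"
    by (rule borel_measurable_inner_hs_op[OF assms assms])
  show ?thesis unfolding norm_eq_sqrt_inner by measurable
qed

lemma bounded_linear_hs_eval: "bounded_linear (\<lambda>T. hs_apply T x)"
  by (rule bounded_linear_intro[where K="norm x"]) (simp_all add: hs_apply_simps norm_hs_apply_le)

text \<open>The set of convergence is measurable because completeness turns it into a countable
  Cauchy condition on norms of differences. On it, weak values of the limit are limits of real
  measurable functions; off it, \<open>lim\<close> is one fixed operator.\<close>

lemma weak_measurable_lim_hs_op:
  fixes F :: "nat \<Rightarrow> 'w \<Rightarrow> ('f::{real_inner,second_countable_topology}, 'g::{real_inner,banach,second_countable_topology}) hs_op"
  assumes F: "\<And>n f g. (\<lambda>\<omega>. inner (hs_apply (F n \<omega>) f) g) \<in> borel_measurable M"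
  shows "(\<lambda>\<omega>. inner (hs_apply (lim (\<lambda>n. F n \<omega>)) f) g) \<in> borel_measurable M"
proof -
  note [measurable] = F
  have [measurable]: "(\<lambda>\<omega>. norm (F m \<omega> - F n \<omega>)) \<in> borel_measurable M" for m n
    by (rule borel_measurable_norm_hs_op) (simp add: hs_apply_minus inner_diff_left)
  have Cauchy_iff: "convergent X \<longleftrightarrow> (\<forall>j. \<exists>N. \<forall>m\<ge>N. \<forall>n\<ge>N. norm (X m - X n) < inverse (real (Suc j)))"
    for X :: "nat \<Rightarrow> ('f, 'g) hs_op"
    unfolding Cauchy_convergent_iff[symmetric] Cauchy_iff
  proof (intro iffI allI impI)
    fix e :: real assume *: "\<forall>j. \<exists>N. \<forall>m\<ge>N. \<forall>n\<ge>N. norm (X m - X n) < inverse (real (Suc j))" and "e > 0"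
    then obtain j where "inverse (real (Suc j)) < e" using reals_Archimedean by blast
    then show "\<exists>N. \<forall>m\<ge>N. \<forall>n\<ge>N. norm (X m - X n) < e" using * by (meson less_trans)
  qed simp
  have meas: "Measurable.pred M (\<lambda>\<omega>. convergent (\<lambda>n. F n \<omega>))"
    unfolding Cauchy_iff by measurable
  \<comment> \<open>The default value of \<open>lim\<close>: for a divergent sequence the predicate
    under its \<open>THE\<close> is constantly false.\<close>
  define c :: "('f, 'g) hs_op" where "c = (THE L. False)"
  have "(\<lambda>\<omega>. inner (hs_apply (lim (\<lambda>n. F n \<omega>)) f) g) =
    (\<lambda>\<omega>. if convergent (\<lambda>n. F n \<omega>) then lim (\<lambda>n. inner (hs_apply (F n \<omega>) f) g) else inner (hs_apply c f) g)"
  proof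
    fix \<omega>
    show "inner (hs_apply (lim (\<lambda>n. F n \<omega>)) f) g =
      (if convergent (\<lambda>n. F n \<omega>) then lim (\<lambda>n. inner (hs_apply (F n \<omega>) f) g) else inner (hs_apply c f) g)"
    proof (cases "convergent (\<lambda>n. F n \<omega>)")
      case True
      then have "(\<lambda>n. F n \<omega>) \<longlonglongrightarrow> lim (\<lambda>n. F n \<omega>)" by (simp add: convergent_LIMSEQ_iff)
      from tendsto_inner[OF bounded_linear.tendsto[OF bounded_linear_hs_eval this] tendsto_const]
      have "(\<lambda>n. inner (hs_apply (F n \<omega>) f) g) \<longlonglongrightarrow> inner (hs_apply (lim (\<lambda>n. F n \<omega>)) f) g" .
      then show ?thesis using True by (simp add: limI)
    next
      case False
      then have "\<not> (\<lambda>n. F n \<omega>) \<longlonglongrightarrow> L" for L by (auto simp: convergent_def)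
      then have "lim (\<lambda>n. F n \<omega>) = c" unfolding lim_def c_def by simp
      then show ?thesis using False by simp
    qed
  qed
  also have "\<dots> \<in> borel_measurable M" using meas by measurable
  finally show ?thesis .
qed

interpretation L2_hs: L2_class M
  "{X :: 'w \<Rightarrow> ('f::{real_inner,second_countable_topology}, 'g::{real_inner,banach,second_countable_topology}) hs_op.
     L2_hs M (\<lambda>\<omega>. hs_apply (X \<omega>))}"
  for M :: "'w measure"
proof
  fix X Y :: "'w \<Rightarrow> ('f, 'g) hs_op"
  assume "X \<in> {X. L2_hs M (\<lambda>\<omega>. hs_apply (X \<omega>))}" "Y \<in> {X. L2_hs M (\<lambda>\<omega>. hs_apply (X \<omega>))}"
  then have XY [measurable]: "(\<lambda>\<omega>. inner (hs_apply (X \<omega>) f) g) \<in> borel_measurable M"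
      "(\<lambda>\<omega>. inner (hs_apply (Y \<omega>) f) g) \<in> borel_measurable M"
    and int: "integrable M (\<lambda>\<omega>. (norm (X \<omega>))\<^sup>2)" "integrable M (\<lambda>\<omega>. (norm (Y \<omega>))\<^sup>2)" for f g
    by (simp_all add: L2_hs_hs_apply_iff)
  show "(\<lambda>\<omega>. inner (X \<omega>) (Y \<omega>)) \<in> borel_measurable M"
    by (rule borel_measurable_inner_hs_op[OF XY])
  show "integrable M (\<lambda>\<omega>. (norm (X \<omega>))\<^sup>2)" by (rule int)
  fix c :: real
  have m: "(\<lambda>\<omega>. inner (hs_apply (X \<omega> + c *\<^sub>R Y \<omega>) f) g) \<in> borel_measurable M" for f g
    by (simp add: hs_apply_simps inner_add_left)
  have [measurable]: "(\<lambda>\<omega>. norm (X \<omega> + c *\<^sub>R Y \<omega>)) \<in> borel_measurable M"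
    by (rule borel_measurable_norm_hs_op[OF m])
  have "integrable M (\<lambda>\<omega>. (norm (X \<omega> + c *\<^sub>R Y \<omega>))\<^sup>2)"
    using integrable_norm_power2_diff[of M X "\<lambda>\<omega>. (- c) *\<^sub>R Y \<omega>"] int by (simp add: power_mult_distrib)
  then show "(\<lambda>\<omega>. X \<omega> + c *\<^sub>R Y \<omega>) \<in> {X. L2_hs M (\<lambda>\<omega>. hs_apply (X \<omega>))}"
    using m by (simp add: L2_hs_hs_apply_iff)
next
  fix F :: "nat \<Rightarrow> 'w \<Rightarrow> ('f, 'g) hs_op"
  assume F: "\<And>n. F n \<in> {X. L2_hs M (\<lambda>\<omega>. hs_apply (X \<omega>))}"
    and lim: "(\<lambda>n. \<integral>\<^sup>+\<omega>. ennreal ((norm (F n \<omega> - lim (\<lambda>m. F m \<omega>)))\<^sup>2) \<partial>M) \<longlonglongrightarrow> 0"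
  have F_meas [measurable]: "(\<lambda>\<omega>. inner (hs_apply (F n \<omega>) f) g) \<in> borel_measurable M"
    and int: "integrable M (\<lambda>\<omega>. (norm (F n \<omega>))\<^sup>2)" for n f g
    using F[of n] by (simp_all add: L2_hs_hs_apply_iff)
  have m [measurable]: "(\<lambda>\<omega>. inner (hs_apply (lim (\<lambda>n. F n \<omega>)) f) g) \<in> borel_measurable M" for f g
    by (rule weak_measurable_lim_hs_op[OF F_meas])
  have [measurable]: "(\<lambda>\<omega>. norm (lim (\<lambda>n. F n \<omega>))) \<in> borel_measurable M"
    by (rule borel_measurable_norm_hs_op[OF m])
  have [measurable]: "(\<lambda>\<omega>. norm (F n \<omega> - lim (\<lambda>m. F m \<omega>))) \<in> borel_measurable M" for n
    by (rule borel_measurable_norm_hs_op) (simp add: hs_apply_minus inner_diff_left)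
  have "integrable M (\<lambda>\<omega>. (norm (lim (\<lambda>n. F n \<omega>)))\<^sup>2)"
    by (rule integrable_norm_power2_lim[OF int lim]) measurable
  then show "(\<lambda>\<omega>. lim (\<lambda>n. F n \<omega>)) \<in> {X. L2_hs M (\<lambda>\<omega>. hs_apply (X \<omega>))}"
    using m by (simp add: L2_hs_hs_apply_iff)
qed

text \<open>Identifies the pointwise encoding with bounded affine maps into \<open>hs_op\<close>;
  coefficients 1, 1 and r, 0 in the linearity clause give additivity and homogeneity.\<close>

lemma hs_bounded_affine_iff:
  fixes \<gamma> :: "'h::real_normed_vector \<Rightarrow> 'f::{real_inner,second_countable_topology} \<Rightarrow> 'g::real_inner"
  shows "hs_bounded_affine \<gamma> \<longleftrightarrow> (\<exists>\<gamma>'. bounded_affine \<gamma>' \<and> \<gamma> = (\<lambda>v. hs_apply (\<gamma>' v)))"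
proof
  assume "hs_bounded_affine \<gamma>"
  then obtain L C K where L: "\<And>v. hilbert_schmidt (L v)" and C: "hilbert_schmidt C"
    and lin: "\<And>a b v w. L (a *\<^sub>R v + b *\<^sub>R w) = (\<lambda>x. a *\<^sub>R L v x + b *\<^sub>R L w x)"
    and K: "\<And>v. hs_norm (L v) \<le> K * norm v" and \<gamma>: "\<And>v. \<gamma> v = (\<lambda>x. L v x + C x)"
    unfolding hs_bounded_affine_def by blast
  have "bounded_linear (\<lambda>v. Abs_hs (L v))"
  proof (rule bounded_linear_intro[where K=K])
    show "Abs_hs (L (v + w)) = Abs_hs (L v) + Abs_hs (L w)" for v w
      using fun_cong[OF lin[of 1 v 1 w]] by (intro hs_op_eqI) (simp add: hs_apply_plus hs_apply_Abs_hs L)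
    show "Abs_hs (L (r *\<^sub>R v)) = r *\<^sub>R Abs_hs (L v)" for r v
      using fun_cong[OF lin[of r v 0 v]] by (intro hs_op_eqI) (simp add: hs_apply_scaleR hs_apply_Abs_hs L)
    show "norm (Abs_hs (L v)) \<le> norm v * K" for v
      using K[of v] by (simp add: norm_hs_op_def hs_apply_Abs_hs L mult.commute)
  qed
  then have "bounded_affine (\<lambda>v. Abs_hs (L v) + Abs_hs C)"
    unfolding bounded_affine_def by blast
  moreover have "\<gamma> = (\<lambda>v. hs_apply (Abs_hs (L v) + Abs_hs C))"
    by (intro ext) (simp add: \<gamma> hs_apply_plus hs_apply_Abs_hs L C)
  ultimately show "\<exists>\<gamma>'. bounded_affine \<gamma>' \<and> \<gamma> = (\<lambda>v. hs_apply (\<gamma>' v))" by blast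
next
  assume "\<exists>\<gamma>' :: 'h \<Rightarrow> ('f, 'g) hs_op. bounded_affine \<gamma>' \<and> \<gamma> = (\<lambda>v. hs_apply (\<gamma>' v))"
  then obtain L and C :: "('f, 'g) hs_op" where L: "bounded_linear L" and \<gamma>: "\<gamma> = (\<lambda>v. hs_apply (L v + C))"
    unfolding bounded_affine_def by auto
  interpret bounded_linear L by fact
  obtain K where "\<And>v. norm (L v) \<le> norm v * K" using bounded by blast
  then show "hs_bounded_affine \<gamma>" unfolding hs_bounded_affine_def \<gamma>
    by (intro exI[of _ "\<lambda>v. hs_apply (L v)"] exI[of _ "hs_apply C"] conjI exI[of _ K])
      (auto simp: hs_apply_simps add scaleR fun_eq_iff norm_hs_op_def mult.commute)
qed

lemma L2_hs_bounded_affine: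
  fixes V :: "'w \<Rightarrow> 'h::{real_normed_vector,second_countable_topology}"
    and \<gamma> :: "'h \<Rightarrow> ('f::{real_inner,second_countable_topology}, 'g::{real_inner,banach,second_countable_topology}) hs_op"
  assumes "finite_measure M" "L2 M V" "bounded_affine \<gamma>"
  shows "L2_hs M (\<lambda>\<omega>. hs_apply (\<gamma> (V \<omega>)))"
  unfolding L2_hs_hs_apply_iff
proof (intro conjI allI)
  fix f g
  have "continuous_on UNIV (\<lambda>v. inner (hs_apply (\<gamma> v) f) g)"
    using bounded_linear.continuous_on[OF bounded_linear_hs_eval bounded_affine_continuous_on[OF assms(3)]]
    by (intro continuous_intros)
  then show "(\<lambda>\<omega>. inner (hs_apply (\<gamma> (V \<omega>)) f) g) \<in> borel_measurable M"
    using assms(2) unfolding L2_def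
    by (auto intro: measurable_compose[OF _ borel_measurable_continuous_onI])
qed (rule integrable_norm_power2_bounded_affine[OF assms])

lemma hs_aff_closure_iff:
  fixes V :: "'w \<Rightarrow> 'h::{real_normed_vector,second_countable_topology}"
    and X :: "'w \<Rightarrow> ('f::{real_inner,second_countable_topology}, 'g::{real_inner,banach,second_countable_topology}) hs_op"
  assumes "finite_measure M" "L2 M V" and Y: "\<And>\<omega>. \<omega> \<in> space M \<Longrightarrow> Y \<omega> = hs_apply (X \<omega>)"
  shows "Y \<in> hs_aff_closure M V \<longleftrightarrow> L2_hs M (\<lambda>\<omega>. hs_apply (X \<omega>)) \<and>
    (\<forall>\<epsilon>>0. \<exists>X'\<in>{\<lambda>\<omega>. \<gamma> (V \<omega>) |\<gamma>. bounded_affine \<gamma>}. (\<integral>\<omega>. (norm (X \<omega> - X' \<omega>))\<^sup>2 \<partial>M) < \<epsilon>)"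
proof -
  have L2: "L2_hs M Y \<longleftrightarrow> L2_hs M (\<lambda>\<omega>. hs_apply (X \<omega>))" by (rule L2_hs_cong[OF Y])
  have eq: "hs_norm (\<lambda>x. Y \<omega> x - hs_apply (\<gamma> (V \<omega>)) x) = norm (X \<omega> - \<gamma> (V \<omega>))" if "\<omega> \<in> space M" for \<gamma> \<omega>
    unfolding norm_hs_op_def by (rule arg_cong[of _ _ hs_norm]) (simp add: fun_eq_iff hs_apply_minus Y that)
  have int: "integrable M (\<lambda>\<omega>. (hs_norm (\<lambda>x. Y \<omega> x - hs_apply (\<gamma> (V \<omega>)) x))\<^sup>2)"
    if "L2_hs M (\<lambda>\<omega>. hs_apply (X \<omega>))" "bounded_affine \<gamma>" for \<gamma>
    using L2_hs.square_integrable[OF L2_hs.diff_closed[of X M "\<lambda>\<omega>. \<gamma> (V \<omega>)"]]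
      L2_hs_bounded_affine[OF assms(1,2) that(2)] that(1)
    by (subst Bochner_Integration.integrable_cong[OF refl]) (auto simp: eq)
  have eq': "(\<integral>\<omega>. (hs_norm (\<lambda>x. Y \<omega> x - hs_apply (\<gamma> (V \<omega>)) x))\<^sup>2 \<partial>M) = (\<integral>\<omega>. (norm (X \<omega> - \<gamma> (V \<omega>)))\<^sup>2 \<partial>M)" for \<gamma>
    by (rule Bochner_Integration.integral_cong) (auto simp: eq)
  have "(\<exists>\<gamma>. hs_bounded_affine \<gamma> \<and> integrable M (\<lambda>\<omega>. (hs_norm (\<lambda>x. Y \<omega> x - \<gamma> (V \<omega>) x))\<^sup>2) \<and>
       (\<integral>\<omega>. (hs_norm (\<lambda>x. Y \<omega> x - \<gamma> (V \<omega>) x))\<^sup>2 \<partial>M) < \<epsilon>) \<longleftrightarrow>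
     (\<exists>X'\<in>{\<lambda>\<omega>. \<gamma> (V \<omega>) |\<gamma>. bounded_affine \<gamma>}. (\<integral>\<omega>. (norm (X \<omega> - X' \<omega>))\<^sup>2 \<partial>M) < \<epsilon>)"
    if "L2_hs M (\<lambda>\<omega>. hs_apply (X \<omega>))" for \<epsilon>
    unfolding hs_bounded_affine_iff using int[OF that] by (auto simp: eq')
  then show ?thesis unfolding hs_aff_closure_def by (simp add: L2 cong: conj_cong)
qed

lemma hs_lin_cond_exp_spec:
  fixes V :: "'w \<Rightarrow> 'h::{real_normed_vector,second_countable_topology}"
    and Z :: "'w \<Rightarrow> 'f::{real_inner,second_countable_topology} \<Rightarrow> 'g::{real_inner,banach,second_countable_topology}"
  assumes "finite_measure M" "L2 M V" "L2_hs M Z"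
  shows "hs_lin_cond_exp M V Z \<in> hs_aff_closure M V"
    and "X \<in> hs_aff_closure M V \<Longrightarrow> (\<integral>\<omega>. hs_inner (\<lambda>x. Z \<omega> x - hs_lin_cond_exp M V Z \<omega> x) (X \<omega>) \<partial>M) = 0"
proof -
  let ?A = "{\<lambda>\<omega>. \<gamma> (V \<omega>) |\<gamma>. bounded_affine \<gamma>} :: ('w \<Rightarrow> ('f, 'g) hs_op) set"
  let ?C = "{X :: 'w \<Rightarrow> ('f, 'g) hs_op. L2_hs M (\<lambda>\<omega>. hs_apply (X \<omega>))}"
  define Z' where "Z' \<omega> = Abs_hs (Z \<omega>)" for \<omega>
  have ZZ: "Z \<omega> = hs_apply (Z' \<omega>)" if "\<omega> \<in> space M" for \<omega>
    using assms(3) that by (simp add: L2_hs_def Z'_def hs_apply_Abs_hs)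
  have ZC: "Z' \<in> ?C" using assms(3) L2_hs_cong[of M Z "\<lambda>\<omega>. hs_apply (Z' \<omega>)"] ZZ by simp
  have A: "?A \<subseteq> ?C" using L2_hs_bounded_affine[OF assms(1,2)] by auto
  have ne: "?A \<noteq> {}" using bounded_affine_const by blast
  obtain F where F: "\<And>n. F n \<in> ?A" "(\<lambda>\<omega>. lim (\<lambda>n. F n \<omega>)) \<in> ?C"
    "(\<lambda>n. \<integral>\<omega>. (norm (lim (\<lambda>m. F m \<omega>) - F n \<omega>))\<^sup>2 \<partial>M) \<longlonglongrightarrow> 0"
    "\<And>X. X \<in> ?A \<Longrightarrow> (\<integral>\<omega>. inner (Z' \<omega> - lim (\<lambda>n. F n \<omega>)) (X \<omega>) \<partial>M) = 0"
    by (rule L2_hs.projection_sequence[OF A ne lincomb_bounded_affine_compose, of Z'])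
      (use ZC in auto)
  define Y where "Y \<omega> = lim (\<lambda>n. F n \<omega>)" for \<omega>
  note F = F[folded Y_def]
  have "\<exists>X\<in>?A. (\<integral>\<omega>. (norm (Y \<omega> - X \<omega>))\<^sup>2 \<partial>M) < \<epsilon>" if "\<epsilon> > 0" for \<epsilon>
    using eventually_happens'[OF sequentially_bot order_tendstoD(2)[OF F(3) that]] F(1) by blast
  then have Y: "(\<lambda>\<omega>. hs_apply (Y \<omega>)) \<in> hs_aff_closure M V"
    using F(2) by (subst hs_aff_closure_iff[OF assms(1,2) refl]) simp
  moreover have "(\<integral>\<omega>. hs_inner (\<lambda>x. Z \<omega> x - hs_apply (Y \<omega>) x) (X \<omega>) \<partial>M) = 0"
    if X: "X \<in> hs_aff_closure M V" for X
  proof -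
    define X' where "X' \<omega> = Abs_hs (X \<omega>)" for \<omega>
    have XX: "X \<omega> = hs_apply (X' \<omega>)" if "\<omega> \<in> space M" for \<omega>
      using X that by (simp add: hs_aff_closure_def L2_hs_def X'_def hs_apply_Abs_hs)
    have "(\<integral>\<omega>. inner (Z' \<omega> - Y \<omega>) (X' \<omega>) \<partial>M) = 0"
    proof (rule L2_hs.orthogonal_closure[OF _ A F(4)])
      show "(\<lambda>\<omega>. Z' \<omega> - Y \<omega>) \<in> ?C" by (rule L2_hs.diff_closed[OF ZC F(2)])
    qed (use X in \<open>simp_all add: hs_aff_closure_iff[OF assms(1,2) XX]\<close>)
    moreover have "inner (Z' \<omega> - Y \<omega>) (X' \<omega>) = hs_inner (\<lambda>x. Z \<omega> x - hs_apply (Y \<omega>) x) (X \<omega>)"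
      if "\<omega> \<in> space M" for \<omega>
    proof -
      have "hs_apply (Z' \<omega> - Y \<omega>) = (\<lambda>x. Z \<omega> x - hs_apply (Y \<omega>) x)"
        by (simp add: fun_eq_iff hs_apply_minus ZZ[OF that])
      then show ?thesis by (simp add: inner_hs_op_def XX[OF that])
    qed
    ultimately show ?thesis
      by (metis (mono_tags, lifting) Bochner_Integration.integral_cong)
  qed
  ultimately have "\<exists>Y. Y \<in> hs_aff_closure M V \<and>
      (\<forall>X\<in>hs_aff_closure M V. (\<integral>\<omega>. hs_inner (\<lambda>x. Z \<omega> x - Y \<omega> x) (X \<omega>) \<partial>M) = 0)"
    by (intro exI[of _ "\<lambda>\<omega>. hs_apply (Y \<omega>)"]) simp
  from someI_ex[OF this, folded hs_lin_cond_exp_def]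
  show "hs_lin_cond_exp M V Z \<in> hs_aff_closure M V"
    and "X \<in> hs_aff_closure M V \<Longrightarrow> (\<integral>\<omega>. hs_inner (\<lambda>x. Z \<omega> x - hs_lin_cond_exp M V Z \<omega> x) (X \<omega>) \<partial>M) = 0"
    by blast+
qed

section \<open>Integrability of evaluations and the mean of the operator-valued projection\<close>

lemma L2_integrable:
  fixes X :: "'w \<Rightarrow> 'k::{real_inner,banach,second_countable_topology}"
  assumes "finite_measure M" "L2 M X"
  shows "integrable M X"
proof -
  interpret finite_measure M by fact
  show ?thesis
  proof (rule Bochner_Integration.integrable_bound)
    show "integrable M (\<lambda>\<omega>. 1 + (norm (X \<omega>))\<^sup>2)" using assms(2) by (simp add: L2_def)
    have "norm x \<le> 1 + (norm x)\<^sup>2" for x :: 'k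
      using sum_squares_bound[of "norm x" 1] norm_ge_zero[of x] by (simp del: norm_ge_zero)
    then show "AE \<omega> in M. norm (X \<omega>) \<le> norm (1 + (norm (X \<omega>))\<^sup>2)" by simp
  qed (use assms in \<open>simp add: L2_def\<close>)
qed

lemma L2_hs_eval_integrable:
  fixes Y :: "'w \<Rightarrow> 'f::{real_inner,second_countable_topology} \<Rightarrow> 'g::{real_inner,banach,second_countable_topology}"
  assumes "finite_measure M" "L2_hs M Y"
  shows "integrable M (\<lambda>\<omega>. Y \<omega> f)"
proof (rule L2_integrable[OF assms(1)])
  have [measurable]: "(\<lambda>\<omega>. Y \<omega> f) \<in> borel_measurable M"
    by (rule borel_measurable_weak) (use assms(2) in \<open>simp add: L2_hs_def\<close>)
  have "norm (Y \<omega> f) \<le> hs_norm (Y \<omega>) * norm f" if "\<omega> \<in> space M" for \<omega>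
    using norm_hs_apply_le[of "Abs_hs (Y \<omega>)" f] assms(2) that
    by (simp add: L2_hs_def hs_apply_Abs_hs norm_hs_op_def)
  then have le: "(norm (Y \<omega> f))\<^sup>2 \<le> (norm f)\<^sup>2 * (hs_norm (Y \<omega>))\<^sup>2" if "\<omega> \<in> space M" for \<omega>
    using power_mono[of "norm (Y \<omega> f)" _ 2] that by (fastforce simp: power_mult_distrib mult.commute)
  have "integrable M (\<lambda>\<omega>. (norm (Y \<omega> f))\<^sup>2)"
  proof (rule Bochner_Integration.integrable_bound)
    show "integrable M (\<lambda>\<omega>. (norm f)\<^sup>2 * (hs_norm (Y \<omega>))\<^sup>2)" using assms(2) by (simp add: L2_hs_def)
    show "AE \<omega> in M. norm ((norm (Y \<omega> f))\<^sup>2) \<le> norm ((norm f)\<^sup>2 * (hs_norm (Y \<omega>))\<^sup>2)"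
      by (rule AE_I2) (simp add: le)
  qed simp
  then show "L2 M (\<lambda>\<omega>. Y \<omega> f)" by (simp add: L2_def)
qed

lemma hs_lin_cond_exp_integral:
  fixes V :: "'w \<Rightarrow> 'h::{real_normed_vector,second_countable_topology}"
    and Z :: "'w \<Rightarrow> 'f::{real_inner,second_countable_topology} \<Rightarrow> 'g::{real_inner,banach,second_countable_topology}"
  assumes "finite_measure M" "L2 M V" "L2_hs M Z"
  shows "(\<integral>\<omega>. hs_lin_cond_exp M V Z \<omega> f \<partial>M) = (\<integral>\<omega>. Z \<omega> f \<partial>M)"
proof -
  let ?P = "hs_lin_cond_exp M V Z"
  have P: "L2_hs M ?P" using hs_lin_cond_exp_spec(1)[OF assms] by (simp add: hs_aff_closure_def)
  have int: "integrable M (\<lambda>\<omega>. Z \<omega> f)" "integrable M (\<lambda>\<omega>. ?P \<omega> f)"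
    by (intro L2_hs_eval_integrable assms P)+
  have "inner (\<integral>\<omega>. Z \<omega> f \<partial>M) g = inner (\<integral>\<omega>. ?P \<omega> f \<partial>M) g" for g
  proof -
    let ?T = "Abs_hs (tensor g f) :: ('f, 'g) hs_op"
    have T: "(\<lambda>\<omega>::'w. tensor g f) \<in> hs_aff_closure M V"
    proof (subst hs_aff_closure_iff[OF assms(1,2), of _ "\<lambda>_. ?T"], goal_cases)
      case 2
      have "L2_hs M (\<lambda>\<omega>. hs_apply ?T)"
        using L2_hs_bounded_affine[OF assms(1,2) bounded_affine_const[of ?T]] .
      moreover have "\<exists>X'\<in>{\<lambda>\<omega>. \<gamma> (V \<omega>) |\<gamma>. bounded_affine \<gamma>}. (\<integral>\<omega>. (norm (?T - X' \<omega>))\<^sup>2 \<partial>M) < \<epsilon>" if "\<epsilon> > 0" for \<epsilon>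
        by (rule bexI[of _ "\<lambda>\<omega>. ?T"]) (use that bounded_affine_const[of ?T] in auto)
      ultimately show ?case by blast
    qed (simp add: hs_apply_Abs_hs hilbert_schmidt_tensor)
    have "hs_inner (\<lambda>x. Z \<omega> x - ?P \<omega> x) (tensor g f) = inner (Z \<omega> f - ?P \<omega> f) g" if "\<omega> \<in> space M" for \<omega>
    proof (rule hs_inner_tensor)
      show "hilbert_schmidt (\<lambda>x. Z \<omega> x - ?P \<omega> x)"
        using hilbert_schmidt_lincomb[of "Z \<omega>" "?P \<omega>" "-1"] P assms(3) that by (simp add: L2_hs_def)
    qed
    then have "(\<integral>\<omega>. inner (Z \<omega> f - ?P \<omega> f) g \<partial>M) = (\<integral>\<omega>. hs_inner (\<lambda>x. Z \<omega> x - ?P \<omega> x) (tensor g f) \<partial>M)"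
      by (intro Bochner_Integration.integral_cong) auto
    also have "\<dots> = 0" by (rule hs_lin_cond_exp_spec(2)[OF assms T])
    finally show ?thesis using int by (simp add: inner_diff_left)
  qed
  then show ?thesis by (metis vector_eq_rdot)
qed

lemma L2_const:
  fixes c :: "'k::{real_inner,banach,second_countable_topology}"
  assumes "finite_measure M"
  shows "L2 M (\<lambda>\<omega>. c)"
proof -
  interpret finite_measure M by fact
  show ?thesis by (simp add: L2_def)
qed

section \<open>Hilbert-valued conditional expectation\<close>

text \<open>The L2 projection \<open>P\<close> onto \<open>G\<close>-measurable functions satisfies
  the defining conditions, so the \<open>SOME\<close> has a witness. The version it picks may differ
  from \<open>P\<close> on a null set; square-integrability and orthogonality are transferred along
  the a.e. equality.\<close>

lemma cond_exp_vec_spec: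
  fixes V :: "'w \<Rightarrow> 'h::topological_space"
    and U :: "'w \<Rightarrow> 'k::{real_inner,banach,second_countable_topology}"
  assumes fin: "finite_measure M" and V: "V \<in> borel_measurable M" and U: "L2 M U"
  defines "G \<equiv> vimage_algebra (space M) V borel"
  shows "cond_exp_vec M V U \<in> borel_measurable G"
    and "L2 M (cond_exp_vec M V U)"
    and "X \<in> borel_measurable G \<Longrightarrow> L2 M X \<Longrightarrow>
      (\<integral>\<omega>. inner (U \<omega> - cond_exp_vec M V U \<omega>) (X \<omega>) \<partial>M) = 0"
proof -
  interpret finite_measure M by fact
  have sub: "subalgebra M G"
    using V unfolding G_def subalgebra_def by (simp add: sets_image_in_sets)
  let ?A = "{X :: 'w \<Rightarrow> 'k. X \<in> borel_measurable G \<and> L2 M X}"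
  have lin: "(\<lambda>\<omega>. X \<omega> + c *\<^sub>R Y \<omega>) \<in> ?A" if "X \<in> ?A" "Y \<in> ?A" for X Y c
    using that L2.lincomb[of X M Y c] by (auto intro: borel_measurable_add borel_measurable_scaleR)
  have ne: "?A \<noteq> {}" using L2_const[OF fin, of 0] by force
  obtain F where F: "\<And>n. F n \<in> ?A" "(\<lambda>\<omega>. lim (\<lambda>n. F n \<omega>)) \<in> {X. L2 M X}"
    "\<And>X. X \<in> ?A \<Longrightarrow> (\<integral>\<omega>. inner (U \<omega> - lim (\<lambda>n. F n \<omega>)) (X \<omega>) \<partial>M) = 0"
    by (rule L2.projection_sequence[of ?A M U]) (use U lin ne in auto)
  define P where "P \<omega> = lim (\<lambda>n. F n \<omega>)" for \<omega>
  note F = F[folded P_def]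
  have PG: "P \<in> borel_measurable G"
    unfolding P_def by (rule borel_measurable_lim_metric) (use F(1) in simp)
  have PL: "L2 M P" using F(2) by simp
  have int: "integrable M U" "integrable M P" by (intro L2_integrable fin U PL)+
  have "set_lebesgue_integral M B P = set_lebesgue_integral M B U" if B: "B \<in> sets G" for B
  proof -
    have BM [measurable]: "B \<in> sets M" using sub B unfolding subalgebra_def by blast
    have i: "integrable M (\<lambda>\<omega>. indicat_real B \<omega> *\<^sub>R U \<omega>)" "integrable M (\<lambda>\<omega>. indicat_real B \<omega> *\<^sub>R P \<omega>)"
      by (intro integrable_mult_indicator BM int)+
    \<comment> \<open>Testing orthogonality with the indicator of \<open>B\<close> times a vector
      \<open>k\<close>, for all \<open>k\<close>, recovers the vector-valued integral over
      \<open>B\<close>.\<close>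
    have "inner (\<integral>\<omega>. indicat_real B \<omega> *\<^sub>R U \<omega> \<partial>M) k = inner (\<integral>\<omega>. indicat_real B \<omega> *\<^sub>R P \<omega> \<partial>M) k" for k
    proof -
      have "(\<lambda>\<omega>. indicat_real B \<omega> *\<^sub>R k) \<in> borel_measurable G" using B by simp
      moreover have "integrable M (\<lambda>\<omega>. (norm (indicat_real B \<omega> *\<^sub>R k))\<^sup>2)"
        by (rule integrable_const_bound[of _ "(norm k)\<^sup>2"]) (auto simp: indicator_def power_mult_distrib)
      ultimately have "(\<lambda>\<omega>. indicat_real B \<omega> *\<^sub>R k) \<in> ?A" by (simp add: L2_def)
      from F(3)[OF this]
      have "(\<integral>\<omega>. inner (indicat_real B \<omega> *\<^sub>R U \<omega> - indicat_real B \<omega> *\<^sub>R P \<omega>) k \<partial>M) = 0"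
        by (simp add: inner_diff_left algebra_simps)
      then show ?thesis using i by (simp add: inner_diff_left del: inner_scaleR_left)
    qed
    then show ?thesis unfolding set_lebesgue_integral_def by (metis vector_eq_rdot)
  qed
  then have ex: "\<exists>Y. Y \<in> borel_measurable G \<and> integrable M Y \<and>
      (\<forall>B\<in>sets G. set_lebesgue_integral M B Y = set_lebesgue_integral M B U)"
    using PG int by blast
  let ?C = "cond_exp_vec M V U"
  have C: "?C \<in> borel_measurable G" "integrable M ?C"
    "\<And>B. B \<in> sets G \<Longrightarrow> set_lebesgue_integral M B ?C = set_lebesgue_integral M B U"
    using someI_ex[OF ex] unfolding cond_exp_vec_def G_def by blast+
  have "AE \<omega> in M. ?C \<omega> = P \<omega>"
  \<comment> \<open>The set integrals agree only over sets of \<open>G\<close>, so uniqueness of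
    densities is applied to the restricted measure, where these are all the measurable sets.\<close>
  proof (rule AE_restr_to_subalg[OF sub])
    interpret R: finite_measure "restr_to_subalg M G"
      by (rule finite_measure_restr_to_subalg[OF sub fin])
    show "AE \<omega> in restr_to_subalg M G. ?C \<omega> = P \<omega>"
    proof (rule R.density_unique_banach)
      show "integrable (restr_to_subalg M G) ?C" "integrable (restr_to_subalg M G) P"
        by (intro integrable_in_subalg sub C PG int)+
      fix B assume "B \<in> sets (restr_to_subalg M G)"
      then have B: "B \<in> sets G" by (simp add: sets_restr_to_subalg[OF sub])
      have "set_lebesgue_integral (restr_to_subalg M G) B f = set_lebesgue_integral M B f"
        if "f \<in> borel_measurable G" for f :: "'w \<Rightarrow> 'k"
        unfolding set_lebesgue_integral_def 
        by (intro integral_subalgebra2[OF sub] borel_measurable_scaleR borel_measurable_indicator that B)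
      then show "set_lebesgue_integral (restr_to_subalg M G) B ?C = set_lebesgue_integral (restr_to_subalg M G) B P"
        using C PG B \<open>\<And>B. B \<in> sets G \<Longrightarrow> set_lebesgue_integral M B P = set_lebesgue_integral M B U\<close> by simp
    qed
  qed
  have Cm [measurable]: "?C \<in> borel_measurable M" and [measurable]: "P \<in> borel_measurable M" "U \<in> borel_measurable M"
    using C PL U by (auto simp: L2_def)
  show "?C \<in> borel_measurable G" by (rule C)
  have "integrable M (\<lambda>\<omega>. (norm (?C \<omega>))\<^sup>2) \<longleftrightarrow> integrable M (\<lambda>\<omega>. (norm (P \<omega>))\<^sup>2)"
    by (rule integrable_cong_AE) (use \<open>AE \<omega> in M. ?C \<omega> = P \<omega>\<close> in auto)
  then show "L2 M ?C" using PL by (simp add: L2_def)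
  show "(\<integral>\<omega>. inner (U \<omega> - ?C \<omega>) (X \<omega>) \<partial>M) = 0" if "X \<in> borel_measurable G" "L2 M X"
  proof -
    have [measurable]: "X \<in> borel_measurable M" using that by (simp add: L2_def)
    have "(\<integral>\<omega>. inner (U \<omega> - ?C \<omega>) (X \<omega>) \<partial>M) = (\<integral>\<omega>. inner (U \<omega> - P \<omega>) (X \<omega>) \<partial>M)"
      by (rule integral_cong_AE) (use \<open>AE \<omega> in M. ?C \<omega> = P \<omega>\<close> in auto)
    then show ?thesis using F(3) that by simp
  qed
qed

section \<open>Covariance operators\<close>

text \<open>A bounded affine map after an affine function of \<open>V\<close> is again one, and
  \<open>T\<close> enlarges the squared L2 error by at most \<open>K^2\<close>. The target space may
  change, which lets the projection of one variable be tested against the residual of the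
  other.\<close>

lemma aff_closure_compose_linear:
  fixes V :: "'w \<Rightarrow> 'h::{real_normed_vector,second_countable_topology}"
    and Y :: "'w \<Rightarrow> 'k::{real_inner,banach,second_countable_topology}"
    and T :: "'k \<Rightarrow> 'l::{real_inner,banach,second_countable_topology}"
  assumes "finite_measure M" "L2 M V" "Y \<in> aff_closure M V" and T: "bounded_linear T"
  shows "(\<lambda>\<omega>. T (Y \<omega>) + a) \<in> aff_closure M V"
proof -
  have Y: "L2 M Y" and appr: "\<And>\<epsilon>. \<epsilon> > 0 \<Longrightarrow>
      \<exists>X\<in>{\<lambda>\<omega>. \<gamma> (V \<omega>) |\<gamma>. bounded_affine \<gamma>}. (\<integral>\<omega>. (norm (Y \<omega> - X \<omega>))\<^sup>2 \<partial>M) < \<epsilon>"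
    using assms(3) unfolding aff_closure_iff[OF assms(1,2)] by blast+
  have aff: "bounded_affine (\<lambda>y. T y + a)" unfolding bounded_affine_def using T by blast
  have TY: "L2 M (\<lambda>\<omega>. T (Y \<omega>) + a)" by (rule L2_bounded_affine[OF assms(1) Y aff])
  obtain K where K: "\<And>x. norm (T x) \<le> norm x * K" using bounded_linear.bounded[OF T] by blast
  have "\<exists>X\<in>{\<lambda>\<omega>. \<gamma> (V \<omega>) |\<gamma>. bounded_affine \<gamma>}. (\<integral>\<omega>. (norm (T (Y \<omega>) + a - X \<omega>))\<^sup>2 \<partial>M) < \<epsilon>"
    if \<epsilon>: "\<epsilon> > 0" for \<epsilon>
  proof -
    \<comment> \<open>The 1 allows division of \<open>\<epsilon>\<close> by the Lipschitz factor
      even if \<open>K = 0\<close>.\<close>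
    have K1: "K\<^sup>2 + 1 > 0" by (simp add: add_nonneg_pos)
    obtain \<gamma> where \<gamma>: "bounded_affine \<gamma>" "(\<integral>\<omega>. (norm (Y \<omega> - \<gamma> (V \<omega>)))\<^sup>2 \<partial>M) < \<epsilon> / (K\<^sup>2 + 1)"
      using appr[OF divide_pos_pos[OF \<epsilon> K1]] by auto
    have aff': "bounded_affine (\<lambda>v. T (\<gamma> v) + a)" by (rule bounded_affine_compose_linear[OF T \<gamma>(1)])
    have Y\<gamma>: "L2 M (\<lambda>\<omega>. Y \<omega> - \<gamma> (V \<omega>))"
      using L2.diff_closed[of Y M "\<lambda>\<omega>. \<gamma> (V \<omega>)"] Y L2_bounded_affine[OF assms(1,2) \<gamma>(1)] by simp
    have TY\<gamma>: "L2 M (\<lambda>\<omega>. (T (Y \<omega>) + a) - (T (\<gamma> (V \<omega>)) + a))"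
      using L2.diff_closed[of "\<lambda>\<omega>. T (Y \<omega>) + a" M "\<lambda>\<omega>. T (\<gamma> (V \<omega>)) + a"] TY
        L2_bounded_affine[OF assms(1,2) aff'] by simp
    have le: "(norm ((T y + a) - (T z + a)))\<^sup>2 \<le> (K\<^sup>2 + 1) * (norm (y - z))\<^sup>2" for y z
    proof -
      have "(norm ((T y + a) - (T z + a)))\<^sup>2 = (norm (T (y - z)))\<^sup>2"
        by (simp add: linear_diff[OF bounded_linear.linear[OF T]])
      also have "\<dots> \<le> (norm (y - z) * K)\<^sup>2" by (intro power_mono K) simp
      also have "\<dots> \<le> (K\<^sup>2 + 1) * (norm (y - z))\<^sup>2" by (simp add: power_mult_distrib algebra_simps)
      finally show ?thesis .
    qed
    have "(\<integral>\<omega>. (norm ((T (Y \<omega>) + a) - (T (\<gamma> (V \<omega>)) + a)))\<^sup>2 \<partial>M)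
        \<le> (\<integral>\<omega>. (K\<^sup>2 + 1) * (norm (Y \<omega> - \<gamma> (V \<omega>)))\<^sup>2 \<partial>M)"
      using Y\<gamma> TY\<gamma> by (intro integral_mono le integrable_mult_right) (simp_all add: L2_def)
    also have "\<dots> = (K\<^sup>2 + 1) * (\<integral>\<omega>. (norm (Y \<omega> - \<gamma> (V \<omega>)))\<^sup>2 \<partial>M)"
      by simp
    also have "\<dots> < \<epsilon>" using \<gamma>(2) K1 by (simp add: pos_less_divide_eq mult.commute)
    finally show ?thesis using aff' by (intro bexI[of _ "\<lambda>\<omega>. T (\<gamma> (V \<omega>)) + a"]) auto
  qed
  then show ?thesis using TY by (simp add: aff_closure_iff[OF assms(1,2)])
qed

lemma aff_closure_const:
  fixes V :: "'w \<Rightarrow> 'h::{real_normed_vector,second_countable_topology}"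
    and c :: "'k::{real_inner,banach,second_countable_topology}"
  assumes "finite_measure M" "L2 M V"
  shows "(\<lambda>\<omega>. c) \<in> aff_closure M V"
  unfolding aff_closure_iff[OF assms]
proof (intro conjI allI impI L2_const assms)
  fix \<epsilon> :: real assume "\<epsilon> > 0"
  then show "\<exists>X\<in>{\<lambda>\<omega>. \<gamma> (V \<omega>) |\<gamma>. bounded_affine \<gamma>}. (\<integral>\<omega>. (norm (c - X \<omega>))\<^sup>2 \<partial>M) < \<epsilon>"
    by (intro bexI[of _ "\<lambda>\<omega>. c"]) (use bounded_affine_const[of c] in auto)
qed

text \<open>Pairing a residual \<open>R\<close> with this function gives the scalar product
  \<open>inner (Y - c) g * inner R f\<close>, precisely a cross term of the covariance.\<close>

lemma aff_closure_inner_scaleR: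
  fixes V :: "'w \<Rightarrow> 'h::{real_normed_vector,second_countable_topology}"
    and Y :: "'w \<Rightarrow> 'k::{real_inner,banach,second_countable_topology}"
    and f :: "'l::{real_inner,banach,second_countable_topology}"
  assumes "finite_measure M" "L2 M V" "Y \<in> aff_closure M V"
  shows "(\<lambda>\<omega>. inner (Y \<omega> - c) g *\<^sub>R f) \<in> aff_closure M V"
proof -
  have "bounded_linear (\<lambda>y. inner y g *\<^sub>R f)"
    by (rule bounded_linear_compose[OF bounded_linear_scaleR_left bounded_linear_inner_left])
  from aff_closure_compose_linear[OF assms this, of "- (inner c g *\<^sub>R f)"]
  show ?thesis by (simp add: inner_diff_left scaleR_diff_left)
qed

section \<open>Means and quadratic forms of covariances\<close>

lemma integral_eq_if_orthogonal_const:
  fixes X Y :: "'w \<Rightarrow> 'k::{real_inner,banach,second_countable_topology}"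
  assumes "finite_measure M" "L2 M X" "L2 M Y" "\<And>k. (\<integral>\<omega>. inner (X \<omega> - Y \<omega>) k \<partial>M) = 0"
  shows "integral\<^sup>L M Y = integral\<^sup>L M X"
proof -
  have "inner (integral\<^sup>L M X) k = inner (integral\<^sup>L M Y) k" for k
    using assms(4)[of k] L2_integrable[OF assms(1,2)] L2_integrable[OF assms(1,3)] by (simp add: inner_diff_left)
  then show ?thesis by (metis vector_eq_rdot)
qed

lemma L2_inner_left:
  fixes X :: "'w \<Rightarrow> 'k::{real_inner,banach,second_countable_topology}"
  assumes "finite_measure M" "L2 M X"
  shows "L2 M (\<lambda>\<omega>. inner (X \<omega>) g)"
  using L2_bounded_affine[OF assms, of "\<lambda>x. inner x g"] bounded_linear_inner_left[of g]
  unfolding bounded_affine_def by (metis add.right_neutral)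

lemma L2_mult_integrable:
  fixes x y :: "'w \<Rightarrow> real"
  assumes "L2 M x" "L2 M y"
  shows "integrable M (\<lambda>\<omega>. x \<omega> * y \<omega>)"
  using L2.inner_integrable[of x M y] assms by simp

lemma L2_diff:
  fixes X Y :: "'w \<Rightarrow> 'k::{real_inner,banach,second_countable_topology}"
  shows "L2 M X \<Longrightarrow> L2 M Y \<Longrightarrow> L2 M (\<lambda>\<omega>. X \<omega> - Y \<omega>)"
  using L2.diff_closed[of X M Y] by simp

lemma L2_tensor_integrable:
  fixes X :: "'w \<Rightarrow> 'g::{real_inner,banach,second_countable_topology}"
    and Y :: "'w \<Rightarrow> 'f::{real_inner,banach,second_countable_topology}"
  assumes "finite_measure M" "L2 M X" "L2 M Y"
  shows "integrable M (\<lambda>\<omega>. tensor (X \<omega>) (Y \<omega>) f)"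
proof (rule Bochner_Integration.integrable_bound)
  have X: "L2 M (\<lambda>\<omega>. norm (X \<omega>))" using assms(2) by (auto simp: L2_def)
  show "integrable M (\<lambda>\<omega>. inner (Y \<omega>) f * norm (X \<omega>))"
    by (rule L2_mult_integrable[OF L2_inner_left[OF assms(1,3)] X])
  show "(\<lambda>\<omega>. tensor (X \<omega>) (Y \<omega>) f) \<in> borel_measurable M"
    using assms(2,3) unfolding tensor_def L2_def
    by (intro borel_measurable_scaleR borel_measurable_inner) auto
qed (simp add: tensor_def abs_mult)

lemma inner_integral_tensor:
  fixes X :: "'w \<Rightarrow> 'g::{real_inner,banach,second_countable_topology}"
    and Y :: "'w \<Rightarrow> 'f::{real_inner,banach,second_countable_topology}"
  assumes "finite_measure M" "L2 M X" "L2 M Y"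
  shows "inner (\<integral>\<omega>. tensor (X \<omega>) (Y \<omega>) f \<partial>M) g = (\<integral>\<omega>. inner (Y \<omega>) f * inner (X \<omega>) g \<partial>M)"
  using integral_inner_left[of g M "\<lambda>\<omega>. tensor (X \<omega>) (Y \<omega>) f"] L2_tensor_integrable[OF assms]
  by (simp add: tensor_def)

lemma inner_cov:
  fixes X :: "'w \<Rightarrow> 'g::{real_inner,banach,second_countable_topology}"
    and Y :: "'w \<Rightarrow> 'f::{real_inner,banach,second_countable_topology}"
  assumes "finite_measure M" "L2 M X" "L2 M Y"
  shows "inner (cov M X Y f) g =
    (\<integral>\<omega>. inner (Y \<omega> - integral\<^sup>L M Y) f * inner (X \<omega> - integral\<^sup>L M X) g \<partial>M)"
  unfolding cov_def by (intro inner_integral_tensor L2_diff L2_const assms)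

text \<open>With equal means, the centred \<open>X\<close> is the centred \<open>Y\<close> plus
  \<open>X - Y\<close>. In direction \<open>g\<close> the cross term is the orthogonality
  hypothesis, and the variance of \<open>X\<close> exceeds that of \<open>Y\<close> by the integral
  of a square.\<close>

lemma loewner_le_cov:
  fixes X Y :: "'w \<Rightarrow> 'g::{real_inner,banach,second_countable_topology}"
  assumes fin: "finite_measure M" and X: "L2 M X" and Y: "L2 M Y"
    and mean: "integral\<^sup>L M Y = integral\<^sup>L M X"
    and orth: "\<And>g. (\<integral>\<omega>. inner (X \<omega> - Y \<omega>) (inner (Y \<omega> - integral\<^sup>L M Y) g *\<^sub>R g) \<partial>M) = 0"
  shows "loewner_le (cov M Y Y) (cov M X X)"
  unfolding loewner_le_def
proof
  fix g
  let ?y = "\<lambda>\<omega>. inner (Y \<omega> - integral\<^sup>L M Y) g" and ?r = "\<lambda>\<omega>. inner (X \<omega> - Y \<omega>) g"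
  have y: "L2 M ?y" and r: "L2 M ?r" by (intro L2_inner_left fin L2_diff X Y L2_const)+
  have x: "inner (X \<omega> - integral\<^sup>L M X) g = ?y \<omega> + ?r \<omega>" for \<omega>
    by (simp add: mean inner_diff_left)
  have "inner (cov M X X g) g = (\<integral>\<omega>. (?y \<omega> + ?r \<omega>) * (?y \<omega> + ?r \<omega>) \<partial>M)"
    unfolding inner_cov[OF fin X X] x ..
  also have "\<dots> = (\<integral>\<omega>. ?y \<omega> * ?y \<omega> + ?r \<omega> * ?r \<omega> + 2 * (?r \<omega> * ?y \<omega>) \<partial>M)"
    by (rule Bochner_Integration.integral_cong) (simp_all add: algebra_simps)
  also have "\<dots> = (\<integral>\<omega>. ?y \<omega> * ?y \<omega> \<partial>M) + (\<integral>\<omega>. ?r \<omega> * ?r \<omega> \<partial>M) + 2 * (\<integral>\<omega>. ?r \<omega> * ?y \<omega> \<partial>M)"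
    using L2_mult_integrable[OF y y] L2_mult_integrable[OF r r] L2_mult_integrable[OF r y] by simp
  also have "(\<integral>\<omega>. ?r \<omega> * ?y \<omega> \<partial>M) = 0"
    using orth[of g] by (simp add: mult.commute)
  finally have "inner (cov M X X g) g = inner (cov M Y Y g) g + (\<integral>\<omega>. ?r \<omega> * ?r \<omega> \<partial>M)"
    by (simp add: inner_cov[OF fin Y Y])
  moreover have "(\<integral>\<omega>. ?r \<omega> * ?r \<omega> \<partial>M) \<ge> 0" by (rule Bochner_Integration.integral_nonneg) simp
  ultimately show "inner (cov M Y Y g) g \<le> inner (cov M X X g) g" by simp
qed

theorem mainTheorem5:
  fixes M :: "'w measure"
    and U :: "'w \<Rightarrow> 'g::{real_inner,banach,second_countable_topology}"
    and V :: "'w \<Rightarrow> 'h::{real_inner,banach,second_countable_topology}"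
    and W :: "'w \<Rightarrow> 'f::{real_inner,banach,second_countable_topology}"
  assumes "prob_space M"
    and "L2 M U" and "L2 M V" and "L2 M W"
    and "L2_hs M (\<lambda>\<omega>. tensor (lin_resid M V U \<omega>) (lin_resid M V W \<omega>))"
  shows "cov M U W = (\<lambda>f'. cov M (lin_cond_exp M V U) (lin_cond_exp M V W) f'
                              + hs_expect M (lin_cond_cov M V U W) f')
       \<and> loewner_le (cov M (cond_exp_vec M V U) (cond_exp_vec M V U)) (cov M U U)
       \<and> loewner_le (cov M (lin_cond_exp M V U) (lin_cond_exp M V U))
                    (cov M (cond_exp_vec M V U) (cond_exp_vec M V U))
       \<and> loewner_le (\<lambda>g. 0) (cov M (lin_cond_exp M V U) (lin_cond_exp M V U))"
proof (intro conjI)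
  interpret prob_space M by fact
  have fin: "finite_measure M" by unfold_locales
  note U = assms(2) and V = assms(3) and W = assms(4)
  let ?A = "lin_cond_exp M V U" and ?B = "lin_cond_exp M V W" and ?C = "cond_exp_vec M V U"
  let ?EA = "integral\<^sup>L M ?A" and ?EB = "integral\<^sup>L M ?B"
  note A = lin_cond_exp_spec[OF fin V U] and B = lin_cond_exp_spec[OF fin V W]
  have LA: "L2 M ?A" and LB: "L2 M ?B" using A(1) B(1) by (simp_all add: aff_closure_iff[OF fin V])
  have EA: "?EA = integral\<^sup>L M U"
    by (rule integral_eq_if_orthogonal_const[OF fin U LA A(2)[OF aff_closure_const[OF fin V]]])
  have EB: "?EB = integral\<^sup>L M W"
    by (rule integral_eq_if_orthogonal_const[OF fin W LB B(2)[OF aff_closure_const[OF fin V]]])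
  show "cov M U W = (\<lambda>f'. cov M ?A ?B f' + hs_expect M (lin_cond_cov M V U W) f')"
  proof
    fix f
    have RU: "L2 M (lin_resid M V U)" and RW: "L2 M (lin_resid M V W)"
      unfolding lin_resid_def by (intro L2_diff U W LA LB)+
    have "hs_expect M (lin_cond_cov M V U W) f = (\<integral>\<omega>. tensor (lin_resid M V U \<omega>) (lin_resid M V W \<omega>) f \<partial>M)"
      unfolding hs_expect_def lin_cond_cov_def by (rule hs_lin_cond_exp_integral[OF fin V assms(5)])
    moreover have "inner (cov M U W f) g = inner (cov M ?A ?B f + (\<integral>\<omega>. tensor (lin_resid M V U \<omega>) (lin_resid M V W \<omega>) f \<partial>M)) g" for g
    proof -
      let ?a = "\<lambda>\<omega>. inner (?A \<omega> - ?EA) g" and ?b = "\<lambda>\<omega>. inner (?B \<omega> - ?EB) f"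
      let ?ru = "\<lambda>\<omega>. inner (lin_resid M V U \<omega>) g" and ?rw = "\<lambda>\<omega>. inner (lin_resid M V W \<omega>) f"
      have L: "L2 M ?a" "L2 M ?b" "L2 M ?ru" "L2 M ?rw"
        by (intro L2_inner_left fin L2_diff LA LB L2_const RU RW)+
      \<comment> \<open>By \<open>EA\<close> and \<open>EB\<close>, each centred variable is its
        centred projection plus its residual; the product is expanded into four scalar
        terms.\<close>
      have "inner (cov M U W f) g = (\<integral>\<omega>. ?b \<omega> * ?a \<omega> + ?rw \<omega> * ?ru \<omega> + ?rw \<omega> * ?a \<omega> + ?ru \<omega> * ?b \<omega> \<partial>M)"
        unfolding inner_cov[OF fin U W]
        by (rule Bochner_Integration.integral_cong)
          (simp_all add: EA EB lin_resid_def inner_diff_left algebra_simps)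
      also have "\<dots> = (\<integral>\<omega>. ?b \<omega> * ?a \<omega> \<partial>M) + (\<integral>\<omega>. ?rw \<omega> * ?ru \<omega> \<partial>M)
          + (\<integral>\<omega>. ?rw \<omega> * ?a \<omega> \<partial>M) + (\<integral>\<omega>. ?ru \<omega> * ?b \<omega> \<partial>M)"
        using L2_mult_integrable[OF L(2,1)] L2_mult_integrable[OF L(4,3)]
          L2_mult_integrable[OF L(4,1)] L2_mult_integrable[OF L(3,2)] by simp
      \<comment> \<open>The residual of \<open>W\<close> is tested against the projection of
        \<open>U\<close> moved into the space of \<open>W\<close> along \<open>f\<close>; the next
        cross term exchanges the roles.\<close>
      also have "(\<integral>\<omega>. ?rw \<omega> * ?a \<omega> \<partial>M) = 0"
        using B(2)[OF aff_closure_inner_scaleR[OF fin V A(1), of ?EA g f]]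
        by (simp add: lin_resid_def mult.commute)
      also have "(\<integral>\<omega>. ?ru \<omega> * ?b \<omega> \<partial>M) = 0"
        using A(2)[OF aff_closure_inner_scaleR[OF fin V B(1), of ?EB f g]]
        by (simp add: lin_resid_def mult.commute)
      finally show ?thesis
        by (simp add: inner_add_left inner_cov[OF fin LA LB] inner_integral_tensor[OF fin RU RW])
    qed
    ultimately show "cov M U W f = cov M ?A ?B f + hs_expect M (lin_cond_cov M V U W) f"
      by (metis vector_eq_rdot)
  qed
  have Vm: "V \<in> borel_measurable M" using V by (simp add: L2_def)
  note C = cond_exp_vec_spec[OF fin Vm U]
  let ?G = "vimage_algebra (space M) V borel"
  have EC: "integral\<^sup>L M ?C = integral\<^sup>L M U"
    by (rule integral_eq_if_orthogonal_const[OF fin U C(2) C(3)]) (simp_all add: L2_const[OF fin])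
  show "loewner_le (cov M ?C ?C) (cov M U U)"
  proof (rule loewner_le_cov[OF fin U C(2) EC C(3)])
    fix g
    show "(\<lambda>\<omega>. inner (?C \<omega> - integral\<^sup>L M ?C) g *\<^sub>R g) \<in> borel_measurable ?G"
      using C(1) by simp
    show "L2 M (\<lambda>\<omega>. inner (?C \<omega> - integral\<^sup>L M ?C) g *\<^sub>R g)"
      using L2_bounded_affine[OF fin L2_inner_left[OF fin L2_diff[OF C(2) L2_const[OF fin]]], of "\<lambda>x. x *\<^sub>R g"]
        bounded_linear_scaleR_left[of g] unfolding bounded_affine_def by (metis add.right_neutral)
  qed
  show "loewner_le (cov M ?A ?A) (cov M ?C ?C)"
  proof (rule loewner_le_cov[OF fin C(2) LA])
    show "?EA = integral\<^sup>L M ?C" by (simp add: EA EC)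
    fix g
    let ?X = "\<lambda>\<omega>. inner (?A \<omega> - ?EA) g *\<^sub>R g"
    have X: "?X \<in> aff_closure M V" by (rule aff_closure_inner_scaleR[OF fin V A(1)])
    then have LX: "L2 M ?X"
      and appr: "\<And>\<epsilon>. \<epsilon> > 0 \<Longrightarrow> \<exists>X\<in>{\<lambda>\<omega>. \<gamma> (V \<omega>) |\<gamma>. bounded_affine \<gamma>}. (\<integral>\<omega>. (norm (?X \<omega> - X \<omega>))\<^sup>2 \<partial>M) < \<epsilon>"
      unfolding aff_closure_iff[OF fin V] by blast+
    \<comment> \<open>\<open>?X\<close> is an L2 limit of affine functions of \<open>V\<close>, but
      as a representative it need not be measurable for \<open>?G\<close>. Orthogonality is
      therefore checked on the affine functions, which are \<open>?G\<close>-measurable, and passed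
      to the limit.\<close>
    have UC: "(\<integral>\<omega>. inner (U \<omega> - ?C \<omega>) (?X \<omega>) \<partial>M) = 0"
    proof (rule L2.orthogonal_closure[OF _ _ _ _ appr])
      show "{\<lambda>\<omega>. \<gamma> (V \<omega>) |\<gamma>. bounded_affine \<gamma>} \<subseteq> {X :: 'w \<Rightarrow> 'g. L2 M X}"
        using L2_bounded_affine[OF fin V] by auto
      show "(\<integral>\<omega>. inner (U \<omega> - ?C \<omega>) (Y \<omega>) \<partial>M) = 0" if "Y \<in> {\<lambda>\<omega>. \<gamma> (V \<omega>) |\<gamma>. bounded_affine \<gamma>}" for Y
      proof -
        obtain \<gamma> where \<gamma>: "Y = (\<lambda>\<omega>. \<gamma> (V \<omega>))" "bounded_affine \<gamma>" using \<open>Y \<in> _\<close> by auto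
        have "V \<in> measurable ?G borel" by (rule measurable_vimage_algebra1) simp
        then have "Y \<in> borel_measurable ?G" unfolding \<gamma>(1)
          by (rule measurable_compose) (rule borel_measurable_continuous_onI[OF bounded_affine_continuous_on[OF \<gamma>(2)]])
        moreover have "L2 M Y" unfolding \<gamma>(1) by (rule L2_bounded_affine[OF fin V \<gamma>(2)])
        ultimately show ?thesis by (rule C(3))
      qed
    qed (use L2_diff[OF U C(2)] LX in auto)
    \<comment> \<open>Since \<open>?C - ?A\<close> is \<open>(U - ?A) - (U - ?C)\<close>, both parts
      are already orthogonal to \<open>?X\<close>; no projection of \<open>?C\<close> itself is
      formed.\<close>
    have "(\<integral>\<omega>. inner (?C \<omega> - ?A \<omega>) (?X \<omega>) \<partial>M)
        = (\<integral>\<omega>. inner (U \<omega> - ?A \<omega>) (?X \<omega>) - inner (U \<omega> - ?C \<omega>) (?X \<omega>) \<partial>M)"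
      by (rule Bochner_Integration.integral_cong) (simp_all add: inner_diff_left algebra_simps)
    also have "\<dots> = (\<integral>\<omega>. inner (U \<omega> - ?A \<omega>) (?X \<omega>) \<partial>M) - (\<integral>\<omega>. inner (U \<omega> - ?C \<omega>) (?X \<omega>) \<partial>M)"
      by (intro Bochner_Integration.integral_diff L2.inner_integrable)
        (use L2_diff[OF U C(2)] L2_diff[OF U LA] LX in auto)
    also have "\<dots> = 0" using UC A(2)[OF X] by simp
    finally show "(\<integral>\<omega>. inner (?C \<omega> - ?A \<omega>) (?X \<omega>) \<partial>M) = 0" .
  qed
  show "loewner_le (\<lambda>g. 0) (cov M ?A ?A)"
    unfolding loewner_le_def inner_cov[OF fin LA LA] by (simp add: Bochner_Integration.integral_nonneg)
qed

end
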